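(* Let $G$ be a $2K_2$-free graph. Then: (1) $G$ has an edge-dominating subgraph $C$ which is a cycle, or a single edge, or a single vertex; (2) if $G$ contains a triangle, then $G$ has an edge-dominating cycle $C$ such that some three successive vertices on $C$ form a triangle in $G$. Moreover, in each case $C$ can be found in time polynomial in $|V(G)|$.
   Context: Graphs are finite, simple, undirected and have at least one vertex. A graph is $2K_2$-free if it does not contain an induced subgraph isomorphic to the disjoint union of two edges. A subgraph $S$ of $G$ is edge-dominating if each edge of $G$ contains at least one vertex from $V(S)$. A cycle is a (not necessarily induced) cycle of length at least $3$ in $G$; an edge is a subgraph consisting of two adjacent vertices and the edge between them. *)

theory Defs
  imports "HOL-Computational_Algebra.Polynomial"
begin

section \<open>Graphs\<close>

datatype 'a graph = Graph (verts: "'a set") (edges: "'a set set")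

definition simple_graph :: "'a graph \<Rightarrow> bool" where
  "simple_graph G \<longleftrightarrow> finite (verts G) \<and> verts G \<noteq> {} \<and>
     (\<forall>e \<in> edges G. e \<subseteq> verts G \<and> card e = 2)"

definition subgraph :: "'a graph \<Rightarrow> 'a graph \<Rightarrow> bool" where
  "subgraph S G \<longleftrightarrow> simple_graph S \<and> verts S \<subseteq> verts G \<and> edges S \<subseteq> edges G"

definition induced_subgraph :: "'a graph \<Rightarrow> 'a set \<Rightarrow> 'a graph" where
  "induced_subgraph G W = Graph W {e \<in> edges G. e \<subseteq> W}"

definition graph_iso :: "'a graph \<Rightarrow> 'b graph \<Rightarrow> bool" where
  "graph_iso G H \<longleftrightarrow> (\<exists>f. bij_betw f (verts G) (verts H) \<and>
     (\<forall>u \<in> verts G. \<forall>v \<in> verts G. {u, v} \<in> edges G \<longleftrightarrow> {f u, f v} \<in> edges H))"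

definition two_K2 :: "nat graph" where
  "two_K2 = Graph {0, 1, 2, 3} {{0, 1}, {2, 3}}"

definition two_K2_free :: "'a graph \<Rightarrow> bool" where
  "two_K2_free G \<longleftrightarrow> \<not> (\<exists>W \<subseteq> verts G. graph_iso (induced_subgraph G W) two_K2)"

definition edge_dominating :: "'a graph \<Rightarrow> 'a graph \<Rightarrow> bool" where
  "edge_dominating G S \<longleftrightarrow> (\<forall>e \<in> edges G. e \<inter> verts S \<noteq> {})"

text \<open>For a list of distinct vertices, \<open>cyclic_graph\<close> is a single vertex (length 1),
  a single edge (length 2) or a cycle (length at least 3).\<close>

definition cyclic_graph :: "'a list \<Rightarrow> 'a graph" where
  "cyclic_graph vs = Graph (set vs)
     {{vs ! i, vs ! (Suc i mod length vs)} | i. i < length vs \<and> 2 \<le> length vs}"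

definition is_cycle :: "'a graph \<Rightarrow> bool" where
  "is_cycle C \<longleftrightarrow> (\<exists>vs. distinct vs \<and> 3 \<le> length vs \<and> C = cyclic_graph vs)"

definition is_single_edge :: "'a graph \<Rightarrow> bool" where
  "is_single_edge C \<longleftrightarrow> (\<exists>u v. u \<noteq> v \<and> C = Graph {u, v} {{u, v}})"

definition is_single_vertex :: "'a graph \<Rightarrow> bool" where
  "is_single_vertex C \<longleftrightarrow> (\<exists>v. C = Graph {v} {})"

text \<open>In a simple graph the three vertices are automatically distinct.\<close>

definition triangle :: "'a graph \<Rightarrow> 'a \<Rightarrow> 'a \<Rightarrow> 'a \<Rightarrow> bool" where
  "triangle G u v w \<longleftrightarrow> {u, v} \<in> edges G \<and> {v, w} \<in> edges G \<and> {u, w} \<in> edges G"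

definition contains_triangle :: "'a graph \<Rightarrow> bool" where
  "contains_triangle G \<longleftrightarrow> (\<exists>u v w. triangle G u v w)"

definition successive_on :: "'a graph \<Rightarrow> 'a \<Rightarrow> 'a \<Rightarrow> 'a \<Rightarrow> bool" where
  "successive_on C u v w \<longleftrightarrow> u \<noteq> w \<and> {u, v} \<in> edges C \<and> {v, w} \<in> edges C"

definition dominating_cycle_edge_or_vertex :: "'a graph \<Rightarrow> 'a graph \<Rightarrow> bool" where
  "dominating_cycle_edge_or_vertex G C \<longleftrightarrow>
     subgraph C G \<and> edge_dominating G C \<and>
     (is_cycle C \<or> is_single_edge C \<or> is_single_vertex C)"

definition dominating_cycle_with_triangle :: "'a graph \<Rightarrow> 'a graph \<Rightarrow> bool" where
  "dominating_cycle_with_triangle G C \<longleftrightarrow>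
     subgraph C G \<and> edge_dominating G C \<and> is_cycle C \<and>
     (\<exists>u v w. successive_on C u v w \<and> triangle G u v w)"


section \<open>Polynomial-time algorithms\<close>

text \<open>Algorithms are programs of a random access machine, presented as a structured
  WHILE language. Every variable names an infinite array of natural numbers; a scalar is
  cell 0 of its array. Each assignment and each test costs one step. As expressions are a
  fixed part of the program and contain only addition and truncated subtraction (no
  multiplication), one step increases the bit length of the numbers in memory by at most a
  constant depending on the program. Hence polynomial time in this unit-cost measure agrees
  with polynomial time on Turing machines.\<close>

type_synonym vname = string
type_synonym state = "vname \<Rightarrow> nat \<Rightarrow> nat"

datatype aexp = N nat | Cell vname aexp | Plus aexp aexp | Minus aexp aexp

datatype bexp = Less aexp aexp | Not bexp | And bexp bexp

datatype com =
    Skip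
  | Assign vname aexp aexp  \<comment> \<open>\<open>Assign x e e'\<close> means \<open>x[e] := e'\<close>\<close>
  | Seq com com
  | If bexp com com
  | While bexp com

fun aval :: "aexp \<Rightarrow> state \<Rightarrow> nat" where
  "aval (N k) s = k"
| "aval (Cell x e) s = s x (aval e s)"
| "aval (Plus e e') s = aval e s + aval e' s"
| "aval (Minus e e') s = aval e s - aval e' s"

fun bval :: "bexp \<Rightarrow> state \<Rightarrow> bool" where
  "bval (Less e e') s \<longleftrightarrow> aval e s < aval e' s"
| "bval (Not b) s \<longleftrightarrow> \<not> bval b s"
| "bval (And b b') s \<longleftrightarrow> bval b s \<and> bval b' s"

text \<open>\<open>exec c s t s'\<close>: started in state \<open>s\<close>, the program \<open>c\<close> terminates in state \<open>s'\<close>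
  after exactly \<open>t\<close> steps. Execution is deterministic.\<close>

inductive exec :: "com \<Rightarrow> state \<Rightarrow> nat \<Rightarrow> state \<Rightarrow> bool" where
  Skip: "exec Skip s 1 s"
| Assign: "exec (Assign x e e') s 1 (s(x := (s x)(aval e s := aval e' s)))"
| Seq: "exec c s t s' \<Longrightarrow> exec c' s' t' s'' \<Longrightarrow> exec (Seq c c') s (t + t') s''"
| IfTrue: "bval b s \<Longrightarrow> exec c s t s' \<Longrightarrow> exec (If b c c') s (Suc t) s'"
| IfFalse: "\<not> bval b s \<Longrightarrow> exec c' s t s' \<Longrightarrow> exec (If b c c') s (Suc t) s'"
| WhileFalse: "\<not> bval b s \<Longrightarrow> exec (While b c) s 1 s"
| WhileTrue: "bval b s \<Longrightarrow> exec c s t s' \<Longrightarrow> exec (While b c) s' t' s'' \<Longrightarrow>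
    exec (While b c) s (Suc (t + t')) s''"

text \<open>A graph with vertex set \<open>{..<n}\<close> is given to a program by \<open>n\<close> and its \<open>n \<times> n\<close>
  adjacency matrix, stored row by row; all other memory is initially 0.\<close>

definition input_state :: "nat graph \<Rightarrow> state" where
  "input_state G = (let n = card (verts G) in (\<lambda>x i. 0)
     (''n'' := (\<lambda>i. if i = 0 then n else 0),
      ''adj'' := (\<lambda>i. if i < n * n \<and> {i div n, i mod n} \<in> edges G then 1 else 0)))"

definition output_list :: "state \<Rightarrow> nat list" where
  "output_list s = map (s ''out'') [0..<s ''len'' 0]"

text \<open>One fixed program finds, for every input graph \<open>G\<close> with \<open>P G\<close>, a subgraph \<open>C\<close> with
  \<open>R G C\<close>, returned as the list of its vertices in (cyclic) order. The number of steps is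
  bounded by a polynomial in the number of vertices of \<open>G\<close>.\<close>

definition poly_time_findable ::
    "(nat graph \<Rightarrow> bool) \<Rightarrow> (nat graph \<Rightarrow> nat graph \<Rightarrow> bool) \<Rightarrow> bool" where
  "poly_time_findable P R \<longleftrightarrow> (\<exists>(c :: com) (p :: nat poly). \<forall>G n.
     simple_graph G \<and> verts G = {..<n} \<and> P G \<longrightarrow>
     (\<exists>t s. exec c (input_state G) t s \<and> t \<le> poly p (card (verts G)) \<and>
        distinct (output_list s) \<and> R G (cyclic_graph (output_list s))))"

end

theory Submission
  imports Defs
begin

text \<open>
  Call a vertex marked by an edge \<open>xy\<close> if it is adjacent to \<open>x\<close> or \<open>y\<close>. Let \<open>C\<close> be a cycle, or
  an edge regarded as a cycle of length two, and let \<open>xy\<close> be an edge disjoint from \<open>C\<close>. As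
  \<open>G\<close> is \<open>2K\<^sub>2\<close>-free, every edge of \<open>C\<close> has a marked end. If both ends of an edge of
  \<open>C\<close> are marked, then \<open>x\<close>, \<open>y\<close> or the path \<open>xy\<close> can be inserted between them and \<open>C\<close> becomes
  longer. Otherwise marked and unmarked vertices alternate on \<open>C\<close>; let \<open>u, v, w\<close> be successive
  with \<open>u\<close> and \<open>w\<close> marked. If \<open>u\<close> and \<open>w\<close> are adjacent to different ends of \<open>xy\<close>, then replacing
  \<open>v\<close> by the path \<open>xy\<close> makes \<open>C\<close> longer. If both are adjacent to \<open>x\<close>, then \<open>v\<close> is replaced by
  \<open>x\<close>. The length stays the same and \<open>xy\<close> becomes dominated. No edge \<open>vz\<close> is lost: if \<open>z\<close> were
  off \<open>C\<close>, then \<open>2K\<^sub>2\<close>-freeness for \<open>vz\<close> and \<open>xy\<close> would give an edge from \<open>z\<close> to \<open>x\<close> or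
  \<open>y\<close>, and \<open>zx\<close> or \<open>zyx\<close> could be inserted between \<open>v\<close> and \<open>w\<close>. So either the length grows or
  the number of undominated edges falls, and after polynomially many steps \<open>C\<close> dominates all
  edges. A graph without edges is dominated by any of its vertices.

  If \<open>G\<close> contains a triangle, the process starts from one, and it keeps three successive vertices
  \<open>h, b, c\<close> of \<open>C\<close> that form a triangle: it inserts nothing into \<open>hb\<close> and \<open>bc\<close> and removes none of
  the three vertices. These restrictions do no harm. If \<open>C\<close> has length at least four, the argument
  above can be applied to the part of \<open>C\<close> that leads from \<open>c\<close> back to \<open>h\<close>. An unmarked inner vertex
  of it lies between two marked ones and can be replaced, and between two successive marked vertices
  something can be inserted. So without a possible move there is just one inner vertex, which is
  marked while \<open>h\<close> and \<open>c\<close> are not, although \<open>hc\<close> is an edge. If \<open>C\<close> is just the triangle, two of its vertices are marked and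
  something can be inserted between them; the other two sides then remain successive on the new
  cycle, so insertion into any side is harmless. The lemmas that carry this are \<open>potential_grow\<close>,
  \<open>potential_exchange\<close> and \<open>dominating_if_stuck\<close>.

  The program stores \<open>C\<close> as a linked list, so that a move takes constantly many steps. It runs
  through all candidates for a move in a fixed order, makes the first move that is possible, and
  starts the search again. Replacements of a single vertex are considered only after all lengthening
  moves have been ruled out, since this is what ensures that they lose no edge. One loop whose body contains no
  further loop suffices for this; its invariant is that all earlier candidates are impossible
  (\<open>search_step\<close>). A numerical measure combining the potential of \<open>C\<close> with the position of the
  search decreases in each iteration and gives the polynomial bound.
\<close>

section \<open>Adjacency and \<open>2K\<^sub>2\<close>-freeness\<close>

definition adj :: "'a graph \<Rightarrow> 'a \<Rightarrow> 'a \<Rightarrow> bool" where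
  "adj G a b \<longleftrightarrow> {a, b} \<in> edges G"

lemma adj_sym: "adj G a b \<longleftrightarrow> adj G b a"
  by (simp add: adj_def insert_commute)

lemma adj_neq: "simple_graph G \<Longrightarrow> adj G a b \<Longrightarrow> a \<noteq> b"
  by (auto simp: adj_def simple_graph_def)

lemma adj_verts: "simple_graph G \<Longrightarrow> adj G a b \<Longrightarrow> a \<in> verts G \<and> b \<in> verts G"
  by (auto simp: adj_def simple_graph_def)

lemma edge_adj:
  assumes "simple_graph G" "e \<in> edges G"
  obtains a b where "e = {a, b}" "adj G a b"
proof -
  have "card e = 2" using assms by (auto simp: simple_graph_def)
  then obtain a b where "e = {a, b}" by (auto simp: card_2_iff)
  with assms(2) show thesis by (intro that) (auto simp: adj_def)
qed

text \<open>Otherwise the four ends induce two disjoint edges.\<close>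

lemma two_K2_free_cross_edge:
  assumes G: "simple_graph G" and free: "two_K2_free G"
    and ab: "adj G a b" and cd: "adj G c d"
    and disj: "a \<noteq> c" "a \<noteq> d" "b \<noteq> c" "b \<noteq> d"
  shows "adj G a c \<or> adj G a d \<or> adj G b c \<or> adj G b d"
proof (rule ccontr)
  assume no: "\<not> ?thesis"
  have neq: "a \<noteq> b" "c \<noteq> d" using G ab cd adj_neq by fastforce+
  let ?W = "{a, b, c, d}"
  let ?f = "\<lambda>v. if v = a then 0 else if v = b then 1 else if v = c then 2 else (3::nat)"
  have "bij_betw ?f ?W {0, 1, 2, 3}"
    unfolding bij_betw_def inj_on_def using disj neq by (auto simp: image_iff)
  moreover have "adj G s t \<longleftrightarrow> {?f s, ?f t} \<in> {{0, 1}, {2, 3}}" if "s \<in> ?W" "t \<in> ?W" for s t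
  proof -
    have irr: "\<not> adj G v v" for v using adj_neq[OF G] by blast
    have no': "\<not> adj G a c" "\<not> adj G a d" "\<not> adj G b c" "\<not> adj G b d"
      "\<not> adj G c a" "\<not> adj G d a" "\<not> adj G c b" "\<not> adj G d b" "adj G b a" "adj G d c"
      using no ab cd adj_sym[of G] by blast+
    from that show ?thesis
      using disj neq no' ab cd irr by (auto simp: doubleton_eq_iff)
  qed
  moreover have "?W \<subseteq> verts G" using G ab cd adj_verts by fastforce
  ultimately have "graph_iso (induced_subgraph G ?W) two_K2"
    unfolding graph_iso_def induced_subgraph_def two_K2_def
    by (intro exI[of _ ?f]) (simp add: adj_def)
  with \<open>?W \<subseteq> verts G\<close> free show False unfolding two_K2_free_def by blast
qed

section \<open>Cyclic successor functions\<close>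

text \<open>A cycle is represented by its successor function. The function is unconstrained outside
  \<open>V\<close>, so that it can be the contents of an array. Every rotation of a witnessing list is again a
  witness, which removes all index arithmetic from insertions and deletions. A fixed point (length
  one) and a transposition (length two) count as cyclic.\<close>

definition cyclic_succ :: "('a \<Rightarrow> 'a) \<Rightarrow> 'a set \<Rightarrow> bool" where
  "cyclic_succ f V \<longleftrightarrow> (\<exists>vs. distinct vs \<and> set vs = V \<and> map f vs = rotate1 vs)"

lemma cyclic_succ_from:
  assumes "cyclic_succ f V" "u \<in> V"
  obtains us where "distinct (u # us)" "set (u # us) = V" "map f (u # us) = us @ [u]"
proof -
  obtain vs where vs: "distinct vs" "set vs = V" "map f vs = rotate1 vs"
    using assms(1) by (auto simp: cyclic_succ_def)
  obtain as bs where split: "vs = as @ u # bs" using assms(2) vs(2) by (metis split_list)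
  let ?r = "rotate (length as) vs"
  have r: "?r = u # (bs @ as)" by (simp add: split rotate_append)
  have "map f ?r = rotate1 ?r"
    by (metis vs(3) rotate_map rotate1_rotate_swap)
  then have "map f (u # (bs @ as)) = (bs @ as) @ [u]" using r by simp
  moreover have "distinct (u # (bs @ as))" "set (u # (bs @ as)) = V"
    using vs(1,2) split by auto
  ultimately show thesis by (rule that[rotated 2])
qed

text \<open>Any set of iterates that closes up is the whole cycle. In particular, a cycle on which the third
  iterate fixes one vertex has at most three vertices.\<close>

lemma cyclic_succ_closed:
  assumes "cyclic_succ f V" "A \<subseteq> V" "A \<noteq> {}" "\<And>a. a \<in> A \<Longrightarrow> f a \<in> A"
  shows "A = V"
proof -
  obtain u where u: "u \<in> A" using assms(3) by blast
  then obtain us where us: "set (u # us) = V" "map f (u # us) = us @ [u]"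
    using cyclic_succ_from[OF assms(1)] assms(2) by blast
  have "(u # us) ! i \<in> A" if "i < length (u # us)" for i
    using that
  proof (induction i)
    case (Suc i)
    then have "f ((u # us) ! i) = (us @ [u]) ! i"
      using us(2) by (metis Suc_lessD nth_map)
    also have "\<dots> = (u # us) ! Suc i" using Suc.prems by (simp add: nth_append)
    finally show ?case using Suc assms(4) by (metis Suc_lessD)
  qed (use u in simp)
  then have "set (u # us) \<subseteq> A" by (metis in_set_conv_nth subsetI)
  then show ?thesis using us(1) assms(2) by blast
qed

lemma cyclic_succ_bij: "cyclic_succ f V \<Longrightarrow> bij_betw f V V"
  unfolding cyclic_succ_def bij_betw_def
  by (metis distinct_map distinct1_rotate set_map set_rotate1)

lemma cyclic_succ_mem: "cyclic_succ f V \<Longrightarrow> u \<in> V \<Longrightarrow> f u \<in> V"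
  using cyclic_succ_bij bij_betwE by fastforce

lemma cyclic_succ_insert:
  assumes "cyclic_succ f V" "u \<in> V" "x \<notin> V"
  shows "cyclic_succ (f(x := f u, u := x)) (insert x V)"
proof -
  obtain us where us: "distinct (u # us)" "set (u # us) = V" "map f (u # us) = us @ [u]"
    using cyclic_succ_from[OF assms(1,2)] .
  have "map (f(x := f u, u := x)) us = map f us"
    using us assms(3) by (intro map_cong) auto
  then have "map (f(x := f u, u := x)) (u # x # us) = rotate1 (u # x # us)"
    using us assms by auto
  then show ?thesis unfolding cyclic_succ_def
    using us assms(3) by (intro exI[of _ "u # x # us"]) auto
qed

lemma cyclic_succ_remove:
  assumes "cyclic_succ f V" "u \<in> V" "f u \<noteq> u"
  shows "cyclic_succ (f(u := f (f u))) (V - {f u})"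
proof -
  obtain us where us: "distinct (u # us)" "set (u # us) = V" "map f (u # us) = us @ [u]"
    using cyclic_succ_from[OF assms(1,2)] .
  then obtain us' where us': "us = f u # us'" using assms(3) by (cases us) auto
  have "map (f(u := f (f u))) us' = map f us'"
    using us us' by (intro map_cong) auto
  then have "map (f(u := f (f u))) (u # us') = rotate1 (u # us')"
    using us us' by auto
  then show ?thesis unfolding cyclic_succ_def
    using us us' by (intro exI[of _ "u # us'"]) auto
qed

section \<open>Local moves on a cycle\<close>

text \<open>When \<open>G\<close> contains a triangle, \<open>base\<close> and its next two successors are the triangle that the
  moves preserve.\<close>

datatype 'a rooted_cycle = Rooted (nxt: "'a \<Rightarrow> 'a") (members: "'a set") (base: 'a)

definition splice :: "'a \<Rightarrow> 'a \<Rightarrow> 'a rooted_cycle \<Rightarrow> 'a rooted_cycle" where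
  "splice u x c = Rooted ((nxt c)(x := nxt c u, u := x)) (insert x (members c)) (base c)"

text \<open>The base is removed only when no triangle is protected; its replacement may then be any vertex
  of the cycle.\<close>

definition bypass :: "'a \<Rightarrow> 'a rooted_cycle \<Rightarrow> 'a rooted_cycle" where
  "bypass u c = Rooted ((nxt c)(u := nxt c (nxt c u))) (members c - {nxt c u})
     (if nxt c u = base c then u else base c)"

text \<open>On a cycle of length three, all sides belong to a triangle. Before something is inserted after
  \<open>u\<close>, the base moves to the other end of that side, so that the triangle is read along the two
  sides that remain. Period three means length three here, because a simple graph has no cycle of
  length one.\<close>

definition reroot :: "'a \<Rightarrow> 'a rooted_cycle \<Rightarrow> 'a rooted_cycle" where
  "reroot u c = Rooted (nxt c) (members c)
     (if nxt c (nxt c (nxt c (base c))) = base c then nxt c u else base c)"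

text \<open>As the other two sides are edges of the cycle, this says that the base and its next two
  successors form a triangle. On a cycle of length two it is false, because the second successor is
  then the base itself.\<close>

definition triangle_at_base :: "'a graph \<Rightarrow> 'a rooted_cycle \<Rightarrow> bool" where
  "triangle_at_base G c \<longleftrightarrow> adj G (base c) (nxt c (nxt c (base c)))"

text \<open>The two protected sides start at the base and at its successor; they may be broken only if the
  cycle is the triangle itself.\<close>

definition may_splice :: "'a graph \<Rightarrow> 'a rooted_cycle \<Rightarrow> 'a \<Rightarrow> bool" where
  "may_splice G c u \<longleftrightarrow> u \<in> members c \<and>
     (triangle_at_base G c \<longrightarrow> u \<noteq> base c \<and> u \<noteq> nxt c (base c) \<or>
        nxt c (nxt c (nxt c (base c))) = base c)"

text \<open>The vertex to be removed is the successor of \<open>u\<close>; the conditions on \<open>u\<close> keep the triangle.\<close>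

definition may_bypass :: "'a graph \<Rightarrow> 'a rooted_cycle \<Rightarrow> 'a \<Rightarrow> bool" where
  "may_bypass G c u \<longleftrightarrow> u \<in> members c \<and>
     (triangle_at_base G c \<longrightarrow> u \<noteq> base c \<and> u \<noteq> nxt c (base c) \<and> nxt c u \<noteq> base c)"

definition cycle_inv :: "'a graph \<Rightarrow> 'a rooted_cycle \<Rightarrow> bool" where
  "cycle_inv G c \<longleftrightarrow> cyclic_succ (nxt c) (members c) \<and> base c \<in> members c \<and>
     (\<forall>a \<in> members c. adj G a (nxt c a)) \<and> (contains_triangle G \<longrightarrow> triangle_at_base G c)"

text \<open>The lengthening moves. Paths are built from their far end, as each vertex is spliced in directly
  after \<open>u\<close>. Adjacency separates all pairs of inserted vertices except \<open>x\<close> and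
  \<open>z\<close> in \<open>grow3\<close>.\<close>

inductive grow :: "'a graph \<Rightarrow> 'a \<Rightarrow> 'a \<Rightarrow> 'a \<Rightarrow> 'a \<Rightarrow> 'a rooted_cycle \<Rightarrow> 'a rooted_cycle \<Rightarrow> bool"
  for G x y z u c where
  grow1: "may_splice G c u \<Longrightarrow> x \<notin> members c \<Longrightarrow> adj G u x \<Longrightarrow> adj G x (nxt c u) \<Longrightarrow>
    grow G x y z u c (splice u x (reroot u c))"
| grow2: "may_splice G c u \<Longrightarrow> x \<notin> members c \<Longrightarrow> y \<notin> members c \<Longrightarrow>
    adj G u x \<Longrightarrow> adj G x y \<Longrightarrow> adj G y (nxt c u) \<Longrightarrow>
    grow G x y z u c (splice u x (splice u y (reroot u c)))"
| grow3: "may_splice G c u \<Longrightarrow> x \<notin> members c \<Longrightarrow> y \<notin> members c \<Longrightarrow> z \<notin> members c \<Longrightarrow> x \<noteq> z \<Longrightarrow>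
    adj G u x \<Longrightarrow> adj G x y \<Longrightarrow> adj G y z \<Longrightarrow> adj G z (nxt c u) \<Longrightarrow>
    grow G x y z u c (splice u x (splice u y (splice u z (reroot u c))))"
| grow_detour: "may_bypass G c u \<Longrightarrow> x \<notin> members c \<Longrightarrow> y \<notin> members c \<Longrightarrow>
    adj G u x \<Longrightarrow> adj G x y \<Longrightarrow> adj G y (nxt c (nxt c u)) \<Longrightarrow>
    grow G x y z u c (splice u x (splice u y (bypass u c)))"

text \<open>Here \<open>y\<close> only certifies that some edge at \<open>x\<close> is undominated, so that the exchange makes
  progress.\<close>

definition can_exchange :: "'a graph \<Rightarrow> 'a \<Rightarrow> 'a \<Rightarrow> 'a \<Rightarrow> 'a rooted_cycle \<Rightarrow> bool" where
  "can_exchange G x y u c \<longleftrightarrow> may_bypass G c u \<and> x \<notin> members c \<and> y \<notin> members c \<and>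
     adj G u x \<and> adj G x y \<and> adj G x (nxt c (nxt c u))"

definition exchange :: "'a \<Rightarrow> 'a \<Rightarrow> 'a rooted_cycle \<Rightarrow> 'a rooted_cycle" where
  "exchange x u c = splice u x (bypass u c)"

definition undominated :: "'a graph \<Rightarrow> 'a set \<Rightarrow> 'a set set" where
  "undominated G V = {e \<in> edges G. e \<inter> V = {}}"

text \<open>During a move the pair formed by \<open>u\<close> and its successor need not be adjacent. All moves pass
  from \<open>cycle_inv\<close> to this weaker invariant by \<open>reroot\<close> or \<open>bypass\<close>, then splice vertices in after
  \<open>u\<close>, and return to \<open>cycle_inv\<close> when the last one is a neighbour of \<open>u\<close>. The conditions on \<open>u\<close>
  in the last line ensure that splicing leaves the protected triangle alone.\<close>

definition cycle_inv_except :: "'a graph \<Rightarrow> 'a \<Rightarrow> 'a rooted_cycle \<Rightarrow> bool" where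
  "cycle_inv_except G u c \<longleftrightarrow> cyclic_succ (nxt c) (members c) \<and> base c \<in> members c \<and>
     u \<in> members c \<and> (\<forall>a \<in> members c - {u}. adj G a (nxt c a)) \<and>
     (contains_triangle G \<longrightarrow> triangle_at_base G c \<and> u \<noteq> base c \<and> u \<noteq> nxt c (base c))"

text \<open>This encodes the lexicographic order by decreasing length and then by the number of undominated
  edges: that number is at most \<open>card (edges G)\<close>, so one more vertex outweighs any change of it.\<close>

definition potential :: "'a graph \<Rightarrow> 'a rooted_cycle \<Rightarrow> nat" where
  "potential G c = (card (verts G) - card (members c)) * Suc (card (edges G)) +
     card (undominated G (members c))"

lemma nxt_splice: "u \<noteq> x \<Longrightarrow> nxt (splice u x c) u = x"
  and members_splice: "members (splice u x c) = insert x (members c)"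
  and reroot_simps: "nxt (reroot u c) = nxt c" "members (reroot u c) = members c"
  and bypass_simps: "nxt (bypass u c) u = nxt c (nxt c u)"
    "members (bypass u c) = members c - {nxt c u}"
  by (simp_all add: splice_def reroot_def bypass_def)

lemma cycle_inv_except_close:
  "cycle_inv_except G u c \<Longrightarrow> adj G u (nxt c u) \<Longrightarrow> cycle_inv G c"
  by (auto simp: cycle_inv_except_def cycle_inv_def)

lemma cycle_inv_except_splice:
  assumes inv: "cycle_inv_except G u c" and x: "x \<notin> members c" "adj G x (nxt c u)"
  shows "cycle_inv_except G u (splice u x c)"
proof -
  have mem: "nxt c (base c) \<in> members c" "base c \<in> members c" "u \<in> members c"
    using inv cyclic_succ_mem by (auto simp: cycle_inv_except_def)
  have "triangle_at_base G (splice u x c) \<and> u \<noteq> base (splice u x c) \<and>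
      u \<noteq> nxt (splice u x c) (base (splice u x c))" if "contains_triangle G"
    using that inv mem x(1)
    by (auto simp: cycle_inv_except_def splice_def triangle_at_base_def)
  then show ?thesis using inv x mem
    by (auto simp: cycle_inv_except_def splice_def cyclic_succ_insert)
qed

section \<open>The moves preserve the invariant and make progress\<close>

context
  fixes G :: "'a graph"
  assumes G: "simple_graph G"
begin

lemma cycle_inv_period3:
  assumes inv: "cycle_inv G c" and per: "nxt c (nxt c (nxt c (base c))) = base c"
    and u: "u \<in> members c"
  shows "nxt c (nxt c (nxt c u)) = u" and "nxt c (nxt c u) \<noteq> u"
proof -
  let ?f = "nxt c" and ?h = "base c"
  have cyc: "cyclic_succ ?f (members c)" and h: "?h \<in> members c"
    and ad: "\<And>a. a \<in> members c \<Longrightarrow> adj G a (?f a)"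
    using inv by (auto simp: cycle_inv_def)
  have "{?h, ?f ?h, ?f (?f ?h)} = members c"
    by (rule cyclic_succ_closed[OF cyc]) (use h cyclic_succ_mem[OF cyc] per in auto)
  then have "u = ?h \<or> u = ?f ?h \<or> u = ?f (?f ?h)" using u by blast
  then show 3: "?f (?f (?f u)) = u" by (elim disjE) (simp_all add: per)
  show "?f (?f u) \<noteq> u" using 3 ad[OF u] adj_neq[OF G] by metis
qed

text \<open>After rerooting, \<open>u\<close> is not the start of a protected side: if the length is three, the base is
  now the successor of \<open>u\<close>, and \<open>u\<close> is the third vertex from there.\<close>

lemma cycle_inv_reroot:
  assumes inv: "cycle_inv G c" and u: "may_splice G c u"
  shows "cycle_inv G (reroot u c)" and
    "triangle_at_base G c \<Longrightarrow> u \<noteq> base (reroot u c) \<and> u \<noteq> nxt c (base (reroot u c))"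
proof -
  let ?f = "nxt c" and ?h = "base c"
  have cyc: "cyclic_succ ?f (members c)" and h: "?h \<in> members c"
    and ad: "\<And>a. a \<in> members c \<Longrightarrow> adj G a (?f a)" and um: "u \<in> members c"
    using inv u by (auto simp: cycle_inv_def may_splice_def)
  have nn: "?f u \<noteq> u" using ad[OF um] adj_neq[OF G] by metis
  show "cycle_inv G (reroot u c)"
  proof (cases "?f (?f (?f ?h)) = ?h")
    case True
    then have "?f (?f (?f u)) = u" using cycle_inv_period3[OF inv True um] by blast
    then show ?thesis using inv cyclic_succ_mem[OF cyc um] True ad[OF um] adj_sym[of G]
      by (simp add: cycle_inv_def reroot_def triangle_at_base_def)
  next
    case False
    then show ?thesis using inv by (simp add: reroot_def)
  qed
  show "u \<noteq> base (reroot u c) \<and> u \<noteq> nxt c (base (reroot u c))" if "triangle_at_base G c"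
    using that u nn cycle_inv_period3[OF inv _ um]
    by (auto simp: reroot_def may_splice_def)
qed

lemma cycle_inv_except_reroot:
  assumes inv: "cycle_inv G c" and u: "may_splice G c u"
  shows "cycle_inv_except G u (reroot u c)"
proof -
  have "members (reroot u c) = members c" "nxt (reroot u c) = nxt c"
    by (simp_all add: reroot_def)
  then show ?thesis using cycle_inv_reroot[OF assms] inv u
    by (auto simp: cycle_inv_def cycle_inv_except_def may_splice_def)
qed

lemma cycle_inv_except_bypass:
  assumes inv: "cycle_inv G c" and u: "may_bypass G c u"
  shows "cycle_inv_except G u (bypass u c)"
proof -
  let ?f = "nxt c" and ?h = "base c"
  have cyc: "cyclic_succ ?f (members c)" and h: "?h \<in> members c" and um: "u \<in> members c"
    and ad: "\<And>a. a \<in> members c \<Longrightarrow> adj G a (?f a)"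
    using inv u by (auto simp: cycle_inv_def may_bypass_def)
  have nn: "?f u \<noteq> u" using ad[OF um] adj_neq[OF G] by metis
  have "cyclic_succ (nxt (bypass u c)) (members (bypass u c))"
    using cyclic_succ_remove[OF cyc um nn] by (simp add: bypass_def)
  moreover have "triangle_at_base G (bypass u c) \<and> u \<noteq> base (bypass u c) \<and>
      u \<noteq> nxt (bypass u c) (base (bypass u c))" if "contains_triangle G"
  proof -
    have "triangle_at_base G c" using that inv by (simp add: cycle_inv_def)
    then show ?thesis using u by (auto simp: may_bypass_def bypass_def triangle_at_base_def)
  qed
  ultimately show ?thesis using um h nn ad
    by (auto simp: cycle_inv_except_def bypass_def)
qed

lemma cycle_inv_grow:
  assumes inv: "cycle_inv G c" and g: "grow G x y z u c c'"
  shows "cycle_inv G c'"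
  using g
proof cases
  case grow1
  have neq: "u \<noteq> x" using grow1 adj_neq[OF G] by blast
  show ?thesis unfolding grow1(1)
    by (intro cycle_inv_except_close[where u = u] cycle_inv_except_splice cycle_inv_except_reroot inv)
      (use grow1 neq in \<open>auto simp: nxt_splice reroot_simps\<close>)
next
  case grow2
  have neq: "u \<noteq> x" "x \<noteq> y" "u \<noteq> y" using grow2 adj_neq[OF G] by (auto simp: may_splice_def)
  show ?thesis unfolding grow2(1)
    by (intro cycle_inv_except_close[where u = u] cycle_inv_except_splice cycle_inv_except_reroot inv)
      (use grow2 neq in \<open>auto simp: nxt_splice members_splice reroot_simps\<close>)
next
  case grow3
  have neq: "u \<noteq> x" "x \<noteq> y" "u \<noteq> y" "y \<noteq> z" "u \<noteq> z"
    using grow3 adj_neq[OF G] by (auto simp: may_splice_def)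
  show ?thesis unfolding grow3(1)
    by (intro cycle_inv_except_close[where u = u] cycle_inv_except_splice cycle_inv_except_reroot inv)
      (use grow3 neq in \<open>auto simp: nxt_splice members_splice reroot_simps\<close>)
next
  case grow_detour
  have neq: "u \<noteq> x" "x \<noteq> y" "u \<noteq> y"
    using grow_detour adj_neq[OF G] by (auto simp: may_bypass_def)
  show ?thesis unfolding grow_detour(1)
    by (intro cycle_inv_except_close[where u = u] cycle_inv_except_splice cycle_inv_except_bypass inv)
      (use grow_detour neq in \<open>auto simp: nxt_splice members_splice bypass_simps\<close>)
qed

lemma cycle_inv_exchange:
  assumes inv: "cycle_inv G c" and e: "can_exchange G x y u c"
  shows "cycle_inv G (exchange x u c)"
proof -
  have neq: "u \<noteq> x" using e adj_neq[OF G] by (auto simp: can_exchange_def)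
  show ?thesis unfolding exchange_def
    by (intro cycle_inv_except_close[where u = u] cycle_inv_except_splice cycle_inv_except_bypass inv)
      (use e neq in \<open>auto simp: can_exchange_def nxt_splice members_splice bypass_simps\<close>)
qed

lemma finite_graph: "finite (verts G)" "finite (edges G)"
proof -
  show "finite (verts G)" using G by (simp add: simple_graph_def)
  moreover have "edges G \<subseteq> Pow (verts G)" using G by (auto simp: simple_graph_def)
  ultimately show "finite (edges G)" by (meson finite_Pow_iff finite_subset)
qed

lemma cycle_inv_members: "cycle_inv G c \<Longrightarrow> members c \<subseteq> verts G"
  using adj_verts[OF G] by (auto simp: cycle_inv_def)

lemma card_undominated: "card (undominated G V) \<le> card (edges G)"
  unfolding undominated_def by (intro card_mono finite_graph) auto

lemma potential_less_if_longer:
  assumes "members c' \<subseteq> verts G" "card (members c) < card (members c')"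
  shows "potential G c' < potential G c"
proof -
  have "card (members c') \<le> card (verts G)" using assms(1) finite_graph card_mono by blast
  then have "Suc (card (verts G) - card (members c')) \<le> card (verts G) - card (members c)"
    using assms(2) by linarith
  then have "Suc (card (verts G) - card (members c')) * Suc (card (edges G)) \<le>
      (card (verts G) - card (members c)) * Suc (card (edges G))"
    by (rule mult_le_mono1)
  then show ?thesis using card_undominated[of "members c'"] unfolding potential_def
    by simp
qed

lemma potential_grow:
  assumes inv: "cycle_inv G c" and g: "grow G x y z u c c'"
  shows "potential G c' < potential G c"
proof (rule potential_less_if_longer)
  show sub: "members c' \<subseteq> verts G" using cycle_inv_members cycle_inv_grow[OF assms] .
  have fin: "finite (members c)"
    using cycle_inv_members[OF inv] finite_graph finite_subset by blast
  have mem: "nxt c a \<in> members c" if "a \<in> members c" for a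
    using inv that cyclic_succ_mem by (auto simp: cycle_inv_def)
  show "card (members c) < card (members c')"
    using g
  proof cases
    case grow_detour
    then have "x \<noteq> y" "nxt c u \<in> members c" using adj_neq[OF G] mem by (auto simp: may_bypass_def)
    moreover have "0 < card (members c)" using fin \<open>nxt c u \<in> members c\<close> card_gt_0_iff by blast
    ultimately show ?thesis using grow_detour fin
      by (simp add: members_splice bypass_simps card_Diff_singleton)
  qed (use fin adj_neq[OF G] in \<open>auto simp: members_splice reroot_simps card_insert_if\<close>)
qed

end

context
  fixes G :: "'a graph"
  assumes G: "simple_graph G" and free: "two_K2_free G"
begin

text \<open>Let \<open>v\<close> be the removed successor of \<open>u\<close>, and \<open>w\<close> the vertex after it. The edge \<open>xy\<close> becomes
  dominated, so it suffices that each neighbour \<open>z\<close> of \<open>v\<close> lies on the new cycle. If it did not, one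
  of the paths \<open>x\<close>, \<open>yx\<close>, \<open>zx\<close>, \<open>zyx\<close> could be inserted between \<open>v\<close> and \<open>w\<close>: either \<open>v\<close> has a
  neighbour in \<open>{x, y}\<close>, or \<open>z\<close> has one by \<open>2K\<^sub>2\<close>-freeness. Such an insertion is permitted because
  \<open>v\<close> may be removed and is hence not one of the first three vertices.\<close>

lemma potential_exchange:
  assumes inv: "cycle_inv G c" and e: "can_exchange G x y u c"
    and no_grow: "\<And>x y z u c'. \<not> grow G x y z u c c'"
  shows "potential G (exchange x u c) < potential G c"
proof -
  let ?V = "members c" and ?v = "nxt c u"
  let ?w = "nxt c ?v" and ?V' = "members (exchange x u c)"
  have um: "u \<in> ?V" and xy: "x \<notin> ?V" "y \<notin> ?V" "adj G x y" and bp: "may_bypass G c u"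
    and xw: "adj G x ?w"
    using e by (auto simp: can_exchange_def may_bypass_def)
  have fin: "finite ?V"
    using cycle_inv_members[OF G inv] finite_graph[OF G] finite_subset by blast
  have cyc: "cyclic_succ (nxt c) ?V" using inv by (simp add: cycle_inv_def)
  have vm: "?v \<in> ?V" using cyclic_succ_mem[OF cyc um] .
  have V': "?V' = insert x (?V - {?v})"
    by (simp add: exchange_def members_splice bypass_simps)
  have "card ?V' = card ?V" using xy vm fin card.remove[OF fin vm] by (simp add: V')
  moreover have "undominated G ?V' \<subset> undominated G ?V"
  proof
    have sv: "may_splice G c ?v"
      using bp vm inj_onD[OF bij_betw_imp_inj_on[OF cyclic_succ_bij[OF cyc]], of u "base c"] um inv
      by (auto simp: may_splice_def may_bypass_def cycle_inv_def)
    have stay: "z \<in> ?V'" if vz: "adj G ?v z" for z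
    proof (rule ccontr)
      assume "z \<notin> ?V'"
      then have z: "z \<notin> ?V" "z \<noteq> x" using vz V' adj_neq[OF G] by auto
      have "\<not> adj G ?v y"
        using grow2[OF sv, of y x] no_grow xy xw adj_sym[of G] by blast
      moreover have "\<not> adj G ?v x"
        using grow1[OF sv, of x] no_grow xy xw by blast
      moreover have "\<not> adj G z x"
        using grow2[OF sv, of z x] no_grow xy xw z vz by blast
      moreover have "\<not> adj G z y"
        using grow3[OF sv, of z y x] no_grow xy xw z vz adj_sym[of G] by blast
      moreover have "z \<noteq> y" using calculation vz by blast
      ultimately show False
        using two_K2_free_cross_edge[OF G free vz xy(3)] z vm xy by blast
    qed
    show "undominated G ?V' \<subseteq> undominated G ?V"
    proof
      fix e assume e: "e \<in> undominated G ?V'"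
      then have "e \<in> edges G" "e \<inter> ?V' = {}" by (auto simp: undominated_def)
      then obtain a b where ab: "e = {a, b}" "adj G a b" using edge_adj[OF G] by metis
      then have "?v \<notin> e" using stay \<open>e \<inter> ?V' = {}\<close> adj_sym[of G] by auto
      then show "e \<in> undominated G ?V"
        using \<open>e \<in> edges G\<close> \<open>e \<inter> ?V' = {}\<close> V' by (auto simp: undominated_def)
    qed
    have "{x, y} \<in> undominated G ?V - undominated G ?V'"
      using xy V' by (auto simp: undominated_def adj_def)
    then show "undominated G ?V' \<noteq> undominated G ?V" by blast
  qed
  then have "card (undominated G ?V') < card (undominated G ?V)"
    by (intro psubset_card_mono) (auto simp: undominated_def finite_graph[OF G])
  ultimately show ?thesis by (simp add: potential_def)
qed

text \<open>An undominated edge \<open>xy\<close> marks at least one end of each edge on the cycle, and at most one where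
  insertion is permitted (\<open>once\<close>). By \<open>gap\<close>, a removable vertex cannot lie between two marked ones.
  Hence a marked vertex at which insertions and removal are permitted is contradictory (\<open>along\<close>): its
  successor is unmarked and the vertex after that is marked again. The rest of the proof finds such
  a vertex.\<close>

lemma dominating_if_stuck:
  assumes inv: "cycle_inv G c"
    and no_grow: "\<And>x y z u c'. \<not> grow G x y z u c c'"
    and no_exchange: "\<And>x y u. \<not> can_exchange G x y u c"
  shows "undominated G (members c) = {}"
proof (rule ccontr)
  let ?V = "members c" and ?f = "nxt c" and ?h = "base c"
  assume "undominated G ?V \<noteq> {}"
  then obtain e where "e \<in> edges G" "e \<inter> ?V = {}" by (auto simp: undominated_def)
  moreover obtain x y where "e = {x, y}" "adj G x y" using edge_adj[OF G \<open>e \<in> edges G\<close>] .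
  ultimately have xy: "adj G x y" "x \<notin> ?V" "y \<notin> ?V" by auto
  have sym: "adj G a b" if "adj G b a" for a b using that adj_sym[of G] by metis
  note yx = sym[OF xy(1)]
  define marked where "marked v \<longleftrightarrow> adj G v x \<or> adj G v y" for v
  have cyc: "cyclic_succ ?f ?V" and h: "?h \<in> ?V"
    and ad: "\<And>a. a \<in> ?V \<Longrightarrow> adj G a (?f a)"
    using inv by (auto simp: cycle_inv_def)
  have mem: "?f a \<in> ?V" if "a \<in> ?V" for a using cyclic_succ_mem[OF cyc that] .
  have inj: "a = b" if "?f a = ?f b" "a \<in> ?V" "b \<in> ?V" for a b
    using that cyclic_succ_bij[OF cyc] by (auto simp: bij_betw_def dest: inj_onD)
  have edge: "marked a \<or> marked b" if "adj G a b" "a \<in> ?V" "b \<in> ?V" for a b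
    using two_K2_free_cross_edge[OF G free that(1) xy(1)] that xy by (auto simp: marked_def)
  have once: "\<not> (marked a \<and> marked (?f a))" if a: "may_splice G c a" for a
  proof
    assume m: "marked a \<and> marked (?f a)"
    have "\<not> adj G a x \<or> \<not> adj G (?f a) x" "\<not> adj G a y \<or> \<not> adj G (?f a) y"
      using grow1[OF a] no_grow xy yx sym by blast+
    moreover have "\<not> adj G a x \<or> \<not> adj G (?f a) y" "\<not> adj G a y \<or> \<not> adj G (?f a) x"
      using grow2[OF a] no_grow xy yx sym by blast+
    ultimately show False using m by (auto simp: marked_def)
  qed
  have gap: "\<not> (marked a \<and> marked (?f (?f a)))" if a: "may_bypass G c a" for a
  proof
    assume m: "marked a \<and> marked (?f (?f a))"
    have "\<not> adj G a x \<or> \<not> adj G (?f (?f a)) x" "\<not> adj G a y \<or> \<not> adj G (?f (?f a)) y"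
      using no_exchange[of x y a] no_exchange[of y x a] a xy yx sym
      by (auto simp: can_exchange_def)
    moreover have "\<not> adj G a x \<or> \<not> adj G (?f (?f a)) y" "\<not> adj G a y \<or> \<not> adj G (?f (?f a)) x"
      using grow_detour[OF a] no_grow xy yx sym by blast+
    ultimately show False using m by (auto simp: marked_def)
  qed
  have along: False if a: "marked a" "may_splice G c a" "may_bypass G c a" "may_splice G c (?f a)" for a
  proof -
    have am: "a \<in> ?V" using a(2) by (simp add: may_splice_def)
    have "\<not> marked (?f a)" using once a by blast
    then have "marked (?f (?f a))" using edge[OF ad[OF mem[OF am]]] mem am by blast
    then show False using gap a by blast
  qed
  show False
  proof (cases "triangle_at_base G c")
    case False
    then have ok: "may_splice G c a \<and> may_bypass G c a" if "a \<in> ?V" for a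
      using that by (simp add: may_splice_def may_bypass_def)
    obtain a where "a \<in> ?V" "marked a" using edge[OF ad[OF h]] h mem by blast
    then show False using along ok mem by blast
  next
    case True
    let ?b = "?f ?h" let ?c = "?f ?b" let ?d = "?f ?c"
    have hc: "adj G ?h ?c" using True by (simp add: triangle_at_base_def)
    show False
    proof (cases "?d = ?h")
      case per: True
      have "may_splice G c a" if "a \<in> ?V" for a
        using that per by (simp add: may_splice_def)
      then have "\<not> (marked ?h \<and> marked ?b)" "\<not> (marked ?b \<and> marked ?c)" "\<not> (marked ?c \<and> marked ?h)"
        using once[of ?h] once[of ?b] once[of ?c] h mem per by auto
      moreover have "marked ?h \<or> marked ?b" "marked ?b \<or> marked ?c" "marked ?h \<or> marked ?c"
        using edge[OF ad[OF h]] edge[OF ad[OF mem[OF h]]] edge[OF hc] h mem by blast+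
      ultimately show False by blast
    next
      case False
      have neq: "?c \<noteq> ?h" "?c \<noteq> ?b" "?b \<noteq> ?h"
        using hc ad[OF h] ad[OF mem[OF h]] adj_neq[OF G] by metis+
      have dneq: "?d \<noteq> ?b" "?d \<noteq> ?c" using neq inj[of ?c ?h] inj[of ?c ?b] h mem by blast+
      have sc: "may_splice G c ?c" and sd: "may_splice G c ?d"
        using neq False dneq h mem by (auto simp: may_splice_def)
      have bc: "may_bypass G c ?c" using neq False h mem by (auto simp: may_bypass_def)
      have "\<not> marked ?c" using along[OF _ sc bc sd] by blast
      then have m: "marked ?h" "marked ?d" using edge[OF hc] edge[OF ad[OF mem[OF mem[OF h]]]] h mem by blast+
      have "\<not> marked (?f ?d)" using once[OF sd] m by blast
      then have w: "?f ?d \<noteq> ?h" using m by metis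
      have "may_bypass G c ?d" using False dneq w h mem by (auto simp: may_bypass_def)
      moreover have "may_splice G c (?f ?d)"
        using w neq False dneq inj[of ?d ?h] h mem by (auto simp: may_splice_def)
      ultimately show False using along[OF m(2) sd] by blast
    qed
  qed
qed

lemma exists_dominating_cycle_inv:
  "cycle_inv G c \<Longrightarrow> \<exists>c'. cycle_inv G c' \<and> undominated G (members c') = {}"
proof (induction c rule: measure_induct_rule[of "potential G"])
  case (less c)
  show ?case
  proof (cases "\<exists>c'. cycle_inv G c' \<and> potential G c' < potential G c")
    case True
    then show ?thesis using less.IH by blast
  next
    case False
    then have no_grow: "\<not> grow G x y z u c c'" for x y z u c'
      using cycle_inv_grow[OF G less.prems] potential_grow[OF G less.prems] by blast
    then have "\<not> can_exchange G x y u c" for x y u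
      using False cycle_inv_exchange[OF G less.prems] potential_exchange[OF less.prems] by blast
    then show ?thesis using dominating_if_stuck[OF less.prems no_grow] less.prems by blast
  qed
qed

end

section \<open>Initial cycles and final outputs\<close>

text \<open>Successors of vertices off the new cycle keep their old values, as in an array of which only
  three entries are overwritten.\<close>

definition start_triangle :: "'a \<Rightarrow> 'a \<Rightarrow> 'a \<Rightarrow> 'a rooted_cycle \<Rightarrow> 'a rooted_cycle" where
  "start_triangle x y z c = Rooted ((nxt c)(x := y, y := z, z := x)) (insert z (insert y (insert x (members c)))) x"

definition start_edge :: "'a \<Rightarrow> 'a \<Rightarrow> 'a rooted_cycle \<Rightarrow> 'a rooted_cycle" where
  "start_edge x y c = Rooted ((nxt c)(x := y, y := x)) (insert y (insert x (members c))) x"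

lemma cycle_inv_start_triangle:
  assumes G: "simple_graph G" and t: "adj G x y" "adj G y z" "adj G x z" and c: "members c = {}"
  shows "cycle_inv G (start_triangle x y z c)"
proof -
  have neq: "x \<noteq> y" "y \<noteq> z" "x \<noteq> z" using t adj_neq[OF G] by blast+
  have "cyclic_succ (nxt (start_triangle x y z c)) {z, y, x}"
    unfolding cyclic_succ_def using neq by (intro exI[of _ "[x, y, z]"]) (auto simp: start_triangle_def)
  then show ?thesis using neq t c adj_sym[of G]
    by (auto simp: cycle_inv_def start_triangle_def triangle_at_base_def)
qed

lemma cycle_inv_start_edge:
  assumes G: "simple_graph G" and t: "adj G x y" and c: "members c = {}"
    and tf: "\<not> contains_triangle G"
  shows "cycle_inv G (start_edge x y c)"
proof -
  have neq: "x \<noteq> y" using t adj_neq[OF G] by blast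
  have "cyclic_succ (nxt (start_edge x y c)) {y, x}"
    unfolding cyclic_succ_def using neq by (intro exI[of _ "[x, y]"]) (auto simp: start_edge_def)
  then show ?thesis using neq t c tf adj_sym[of G]
    by (auto simp: cycle_inv_def start_edge_def)
qed

lemma contains_triangle_adj:
  "contains_triangle G \<longleftrightarrow> (\<exists>x y z. adj G x y \<and> adj G y z \<and> adj G x z)"
  by (simp add: contains_triangle_def triangle_def adj_def)

lemma edges_cyclic_graph:
  assumes "map f us = rotate1 us" "2 \<le> length us"
  shows "edges (cyclic_graph us) = (\<lambda>a. {a, f a}) ` set us"
proof -
  have "us ! (Suc i mod length us) = f (us ! i)" if "i < length us" for i
    using nth_rotate1[OF that] assms(1) that by (metis nth_map)
  then have "edges (cyclic_graph us) = (\<lambda>i. {us ! i, f (us ! i)}) ` {..<length us}"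
    using assms(2) by (auto simp: cyclic_graph_def)
  also have "\<dots> = (\<lambda>a. {a, f a}) ` set us"
    by (auto simp: set_conv_nth)
  finally show ?thesis .
qed

text \<open>A single output satisfies both claims, so one program can serve for both.\<close>

definition required_output :: "'a graph \<Rightarrow> 'a graph \<Rightarrow> bool" where
  "required_output G C \<longleftrightarrow> dominating_cycle_edge_or_vertex G C \<and>
     (contains_triangle G \<longrightarrow> dominating_cycle_with_triangle G C)"

lemma required_output_cyclic_graph:
  assumes G: "simple_graph G" and inv: "cycle_inv G c" and dom: "undominated G (members c) = {}"
    and us: "distinct us" "set us = members c" "map (nxt c) us = rotate1 us"
  shows "required_output G (cyclic_graph us)"
proof -
  let ?C = "cyclic_graph us" and ?f = "nxt c" and ?h = "base c"
  have cyc: "cyclic_succ ?f (members c)" and h: "?h \<in> members c"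
    and ad: "\<And>a. a \<in> members c \<Longrightarrow> adj G a (?f a)"
    using inv by (auto simp: cycle_inv_def)
  have mem: "?f a \<in> members c" if "a \<in> members c" for a using cyclic_succ_mem[OF cyc that] .
  have neq: "?f a \<noteq> a" if "a \<in> members c" for a using ad[OF that] adj_neq[OF G] by metis
  have len: "length us = card (members c)" using us by (metis distinct_card)
  have fin: "finite (members c)" using us by (metis List.finite_set)
  have "card {?h, ?f ?h} \<le> card (members c)" using fin h mem by (intro card_mono) auto
  then have len2: "2 \<le> length us" using neq[OF h] len by auto
  note E = edges_cyclic_graph[OF us(3) len2]
  have V: "verts ?C = members c" by (simp add: cyclic_graph_def us)
  have "card {a, ?f a} = 2" if "a \<in> members c" for a
    using neq[OF that] by (metis card_2_iff)
  then have sub: "subgraph ?C G"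
    using fin h ad cycle_inv_members[OF G inv]
    by (auto simp: subgraph_def simple_graph_def E V us adj_def mem)
  have edom: "edge_dominating G ?C"
    using dom by (auto simp: edge_dominating_def undominated_def V)
  have tri: "is_cycle ?C \<and> (\<exists>u v w. successive_on ?C u v w \<and> triangle G u v w)"
    if "triangle_at_base G c"
  proof -
    have t: "adj G ?h (?f (?f ?h))" using that by (simp add: triangle_at_base_def)
    then have n3: "?f (?f ?h) \<noteq> ?h" using adj_neq[OF G] by metis
    have "card {?h, ?f ?h, ?f (?f ?h)} \<le> card (members c)" using fin h mem by (intro card_mono) auto
    then have "3 \<le> length us" using neq[OF h] neq[OF mem[OF h]] n3 len by auto
    then have "is_cycle ?C" using us(1) by (auto simp: is_cycle_def)
    moreover have "successive_on ?C ?h (?f ?h) (?f (?f ?h))"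
      using n3 h mem by (auto simp: successive_on_def E us)
    moreover have "triangle G ?h (?f ?h) (?f (?f ?h))"
      using t ad h mem by (auto simp: triangle_def adj_def)
    ultimately show ?thesis by blast
  qed
  have "is_cycle ?C \<or> is_single_edge ?C"
  proof (cases "3 \<le> length us")
    case True
    then show ?thesis using us(1) by (auto simp: is_cycle_def)
  next
    case False
    then have "length us = Suc (Suc 0)" using len2 by simp
    then obtain a b where ab: "us = [a, b]" by (auto simp: length_Suc_conv)
    then have "?C = Graph {a, b} {{a, b}}" "a \<noteq> b"
      using us(1) by (auto simp: cyclic_graph_def less_Suc_eq insert_commute intro: exI[of _ 0])
    then show ?thesis by (auto simp: is_single_edge_def)
  qed
  moreover have "contains_triangle G \<longrightarrow> triangle_at_base G c"
    using inv by (simp add: cycle_inv_def)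
  ultimately show ?thesis using sub edom tri
    unfolding required_output_def dominating_cycle_edge_or_vertex_def
      dominating_cycle_with_triangle_def by blast
qed

lemma required_output_single_vertex:
  assumes G: "simple_graph G" and v: "v \<in> verts G" and no: "\<And>a b. \<not> adj G a b"
  shows "required_output G (cyclic_graph [v])"
proof -
  have "edges G = {}" using no edge_adj[OF G] by (metis all_not_in_conv)
  moreover have "cyclic_graph [v] = Graph {v} {}" by (simp add: cyclic_graph_def)
  moreover have "\<not> contains_triangle G" using no by (simp add: contains_triangle_adj)
  ultimately show ?thesis using v
    by (auto simp: required_output_def dominating_cycle_edge_or_vertex_def subgraph_def
        simple_graph_def edge_dominating_def is_single_vertex_def)
qed

text \<open>Both existence claims for graphs over an arbitrary type.\<close>

lemma required_output_exists:
  assumes G: "simple_graph G" and free: "two_K2_free G"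
  shows "\<exists>C. required_output G C"
proof (cases "\<exists>a b. adj G a b")
  case False
  obtain v where "v \<in> verts G" using G by (auto simp: simple_graph_def)
  then show ?thesis using required_output_single_vertex[OF G] False by blast
next
  case True
  then obtain a b where ab: "adj G a b" by blast
  let ?c = "Rooted id {} a"
  have "\<exists>c. cycle_inv G c"
  proof (cases "contains_triangle G")
    case True
    then show ?thesis using cycle_inv_start_triangle[OF G, where c = ?c]
      by (auto simp: contains_triangle_adj)
  next
    case False
    then show ?thesis using cycle_inv_start_edge[OF G ab, of ?c] by auto
  qed
  then obtain c where inv: "cycle_inv G c" and dom: "undominated G (members c) = {}"
    using exists_dominating_cycle_inv[OF G free] by blast
  moreover obtain us where "distinct us" "set us = members c" "map (nxt c) us = rotate1 us"
    using inv by (auto simp: cycle_inv_def cyclic_succ_def)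
  ultimately show ?thesis using required_output_cyclic_graph[OF G] by blast
qed

section \<open>Executing programs\<close>

text \<open>The effect of a program without loops is a function of the state that the simplifier can
  compute. Only loops around such programs then need an invariant.\<close>

fun loop_free :: "com \<Rightarrow> bool" where
  "loop_free (Seq c d) \<longleftrightarrow> loop_free c \<and> loop_free d"
| "loop_free (If b c d) \<longleftrightarrow> loop_free c \<and> loop_free d"
| "loop_free (While b c) \<longleftrightarrow> False"
| "loop_free _ \<longleftrightarrow> True"

fun run :: "com \<Rightarrow> state \<Rightarrow> state" where
  "run (Assign x e e') s = s(x := (s x)(aval e s := aval e' s))"
| "run (Seq c d) s = run d (run c s)"
| "run (If b c d) s = (if bval b s then run c s else run d s)"
| "run _ s = s"

text \<open>Both branches of a conditional are charged, so that the bound does not depend on the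
  state.\<close>

fun cost :: "com \<Rightarrow> nat" where
  "cost (Seq c d) = cost c + cost d"
| "cost (If b c d) = Suc (cost c + cost d)"
| "cost _ = 1"

lemma exec_loop_free: "loop_free c \<Longrightarrow> \<exists>t \<le> cost c. exec c s t (run c s)"
proof (induction c arbitrary: s)
  case Skip
  show ?case by (intro exI[of _ 1] conjI) (use exec.Skip in auto)
next
  case (Assign x e e')
  show ?case by (intro exI[of _ 1] conjI) (simp_all only: cost.simps run.simps exec.Assign order_refl)
next
  case (Seq c d)
  obtain t where "t \<le> cost c" "exec c s t (run c s)" using Seq by auto
  moreover obtain t' where "t' \<le> cost d" "exec d (run c s) t' (run d (run c s))"
    using Seq by auto
  ultimately show ?case by (intro exI[of _ "t + t'"]) (auto intro: exec.Seq)
next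
  case (If b c d)
  obtain t where t: "t \<le> cost c" "exec c s t (run c s)" using If by auto
  obtain t' where t': "t' \<le> cost d" "exec d s t' (run d s)" using If by auto
  show ?case
  proof (cases "bval b s")
    case True
    then show ?thesis using t by (intro exI[of _ "Suc t"]) (auto intro: exec.IfTrue)
  next
    case False
    then show ?thesis using t' by (intro exI[of _ "Suc t'"]) (auto intro: exec.IfFalse)
  qed
qed simp

text \<open>The measure \<open>\<mu>\<close> bounds the number of iterations, and each iteration costs at most \<open>cost c\<close>
  steps and one test.\<close>

lemma exec_while:
  fixes \<mu> :: "state \<Rightarrow> nat"
  assumes lf: "loop_free c"
    and step: "\<And>s. I s \<Longrightarrow> bval b s \<Longrightarrow> I (run c s) \<and> \<mu> (run c s) < \<mu> s"
  shows "I s \<Longrightarrow> \<exists>t s'. exec (While b c) s t s' \<and> t \<le> Suc (\<mu> s * Suc (cost c)) \<and> I s' \<and> \<not> bval b s'"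
proof (induction s rule: measure_induct_rule[of \<mu>])
  case (less s)
  show ?case
  proof (cases "bval b s")
    case False
    then show ?thesis using exec.WhileFalse[OF False, of c] less.prems by fastforce
  next
    case True
    note st = step[OF less.prems True]
    obtain t where t: "t \<le> cost c" "exec c s t (run c s)" using exec_loop_free[OF lf] by blast
    obtain t' s' where t': "exec (While b c) (run c s) t' s'"
      "t' \<le> Suc (\<mu> (run c s) * Suc (cost c))" "I s'" "\<not> bval b s'"
      using less.IH st by blast
    have "Suc (t + t') \<le> Suc (Suc (\<mu> (run c s)) * Suc (cost c))" using t(1) t'(2) by simp
    also have "\<dots> \<le> Suc (\<mu> s * Suc (cost c))"
      using st by (metis Suc_leI Suc_le_mono mult_le_mono1)
    finally show ?thesis using exec.WhileTrue[OF True t(2) t'(1)] t'(3,4) by blast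
  qed
qed

section \<open>The search program\<close>

text \<open>Capitalised names denote pieces of program text. The arrays \<open>nx\<close> and \<open>on\<close> hold the
  successor function and the membership flags of the current cycle, \<open>h\<close> its base. The scalars
  \<open>x\<close>, \<open>y\<close>, \<open>z\<close>, \<open>u\<close> hold the candidate under examination and \<open>p\<close> the phase of the search.\<close>

abbreviation Var :: "vname \<Rightarrow> aexp" where "Var x \<equiv> Cell x (N 0)"
abbreviation Let_Var :: "vname \<Rightarrow> aexp \<Rightarrow> com" where "Let_Var x e \<equiv> Assign x (N 0) e"
abbreviation Nxt :: "aexp \<Rightarrow> aexp" where "Nxt e \<equiv> Cell ''nx'' e"

definition Or :: "bexp \<Rightarrow> bexp \<Rightarrow> bexp" where "Or b c = Not (And (Not b) (Not c))"
definition Eq :: "aexp \<Rightarrow> aexp \<Rightarrow> bexp" where "Eq d e = And (Not (Less d e)) (Not (Less e d))"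
definition On :: "aexp \<Rightarrow> bexp" where "On e = Less (N 0) (Cell ''on'' e)"

text \<open>The language has no multiplication, so the offsets of the rows of the adjacency matrix are read
  from a table.\<close>

definition Adj :: "aexp \<Rightarrow> aexp \<Rightarrow> bexp" where
  "Adj d e = Less (N 0) (Cell ''adj'' (Plus (Cell ''row'' d) e))"

fun Ands :: "bexp list \<Rightarrow> bexp" where
  "Ands [] = Not (Less (N 0) (N 0))"
| "Ands (b # bs) = And b (Ands bs)"

fun Seqs :: "com list \<Rightarrow> com" where
  "Seqs [] = Skip"
| "Seqs (c # cs) = Seq c (Seqs cs)"

lemma bval_Or [simp]: "bval (Or b c) s \<longleftrightarrow> bval b s \<or> bval c s"
  and bval_Eq [simp]: "bval (Eq d e) s \<longleftrightarrow> aval d s = aval e s"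
  and bval_On [simp]: "bval (On e) s \<longleftrightarrow> 0 < s ''on'' (aval e s)"
  by (auto simp: Or_def Eq_def On_def)

lemma bval_Ands [simp]: "bval (Ands bs) s \<longleftrightarrow> (\<forall>b \<in> set bs. bval b s)"
  by (induction bs) auto

lemma loop_free_Seqs [simp]: "loop_free (Seqs cs) \<longleftrightarrow> (\<forall>c \<in> set cs. loop_free c)"
  by (induction cs) auto

definition Triangle_At_Base :: bexp where
  "Triangle_At_Base = Adj (Var ''h'') (Nxt (Nxt (Var ''h'')))"

definition Period3 :: bexp where
  "Period3 = Eq (Nxt (Nxt (Nxt (Var ''h'')))) (Var ''h'')"

definition May_Splice :: bexp where
  "May_Splice = And (On (Var ''u'')) (Or (Not Triangle_At_Base) (Or Period3
     (And (Not (Eq (Var ''u'') (Var ''h''))) (Not (Eq (Var ''u'') (Nxt (Var ''h'')))))))"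

definition May_Bypass :: bexp where
  "May_Bypass = And (On (Var ''u'')) (Or (Not Triangle_At_Base)
     (Ands [Not (Eq (Var ''u'') (Var ''h'')), Not (Eq (Var ''u'') (Nxt (Var ''h''))),
       Not (Eq (Nxt (Var ''u'')) (Var ''h''))]))"

definition Splice :: "vname \<Rightarrow> com" where
  "Splice a = Seqs [Assign ''nx'' (Var a) (Nxt (Var ''u'')), Assign ''nx'' (Var ''u'') (Var a),
     Assign ''on'' (Var a) (N 1)]"

definition Bypass :: com where
  "Bypass = Seqs [If (Eq (Nxt (Var ''u'')) (Var ''h'')) (Let_Var ''h'' (Var ''u'')) Skip,
     Assign ''on'' (Nxt (Var ''u'')) (N 0), Assign ''nx'' (Var ''u'') (Nxt (Nxt (Var ''u'')))]"

definition Reroot :: com where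
  "Reroot = If Period3 (Let_Var ''h'' (Nxt (Var ''u''))) Skip"

definition Start_Triangle :: com where
  "Start_Triangle = Seqs [Assign ''nx'' (Var ''x'') (Var ''y''), Assign ''nx'' (Var ''y'') (Var ''z''),
     Assign ''nx'' (Var ''z'') (Var ''x''), Assign ''on'' (Var ''x'') (N 1),
     Assign ''on'' (Var ''y'') (N 1), Assign ''on'' (Var ''z'') (N 1), Let_Var ''h'' (Var ''x'')]"

definition Start_Edge :: com where
  "Start_Edge = Seqs [Assign ''nx'' (Var ''x'') (Var ''y''), Assign ''nx'' (Var ''y'') (Var ''x''),
     Assign ''on'' (Var ''x'') (N 1), Assign ''on'' (Var ''y'') (N 1), Let_Var ''h'' (Var ''x'')]"

text \<open>Each move is a guard followed by its effect. Phases 0 and 1 look for an initial triangle and an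
  initial edge, phase 2 for a lengthening move, phase 3 for an exchange.\<close>

definition moves :: "(bexp \<times> com) list" where
  "moves =
    (let u = Var ''u''; x = Var ''x''; y = Var ''y''; z = Var ''z'';
         v = Nxt u; w = Nxt v; in_phase = (\<lambda>k. Eq (Var ''p'') (N k)) in
     [(Ands [in_phase 0, Adj x y, Adj y z, Adj x z], Start_Triangle),
      (Ands [in_phase 1, Adj x y], Start_Edge),
      (Ands [in_phase 2, May_Splice, Not (On x), Adj u x, Adj x v],
        Seqs [Reroot, Splice ''x'']),
      (Ands [in_phase 2, May_Splice, Not (On x), Not (On y), Adj u x, Adj x y, Adj y v],
        Seqs [Reroot, Splice ''y'', Splice ''x'']),
      (Ands [in_phase 2, May_Splice, Not (On x), Not (On y), Not (On z), Not (Eq x z),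
          Adj u x, Adj x y, Adj y z, Adj z v],
        Seqs [Reroot, Splice ''z'', Splice ''y'', Splice ''x'']),
      (Ands [in_phase 2, May_Bypass, Not (On x), Not (On y), Adj u x, Adj x y, Adj y w],
        Seqs [Bypass, Splice ''y'', Splice ''x'']),
      (Ands [in_phase 3, May_Bypass, Not (On x), Not (On y), Adj u x, Adj x y, Adj x w],
        Seqs [Bypass, Splice ''x''])])"

text \<open>After any move the search resumes at phase 2: a nonempty cycle is present from then on.\<close>

definition Restart :: com where
  "Restart = Seqs [Let_Var ''p'' (N 2), Let_Var ''x'' (N 0), Let_Var ''y'' (N 0),
     Let_Var ''z'' (N 0), Let_Var ''u'' (N 0)]"

text \<open>An odometer whose digits range over \<open>{..<n}\<close> and whose overflow advances the phase.\<close>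

fun Tick :: "vname list \<Rightarrow> com" where
  "Tick [] = Let_Var ''p'' (Plus (Var ''p'') (N 1))"
| "Tick (a # as) = Seq (Let_Var a (Plus (Var a) (N 1)))
     (If (Less (Var a) (Var ''n'')) Skip (Seq (Let_Var a (N 0)) (Tick as)))"

fun First_Of :: "(bexp \<times> com) list \<Rightarrow> com \<Rightarrow> com" where
  "First_Of [] d = d"
| "First_Of ((b, c) # ms) d = If b (Seq c Restart) (First_Of ms d)"

definition Search_Body :: com where
  "Search_Body = First_Of moves (Tick [''u'', ''z'', ''y'', ''x''])"

section \<open>Correspondence of the program with the moves\<close>

text \<open>The moves that the guards select, with the phase as a precondition. For phases 0 and 1 the
  requirement that there be no cycle yet makes every such candidate impossible once a cycle exists;
  thus a single invariant covers all phases.\<close>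

inductive found :: "'a graph \<Rightarrow> nat \<Rightarrow> 'a \<Rightarrow> 'a \<Rightarrow> 'a \<Rightarrow> 'a \<Rightarrow> 'a rooted_cycle \<Rightarrow> 'a rooted_cycle \<Rightarrow> bool"
  for G p x y z u c where
  "p = 0 \<Longrightarrow> members c = {} \<Longrightarrow> adj G x y \<Longrightarrow> adj G y z \<Longrightarrow> adj G x z \<Longrightarrow>
    found G p x y z u c (start_triangle x y z c)"
| "p = 1 \<Longrightarrow> members c = {} \<Longrightarrow> adj G x y \<Longrightarrow> found G p x y z u c (start_edge x y c)"
| "p = 2 \<Longrightarrow> grow G x y z u c c' \<Longrightarrow> found G p x y z u c c'"
| "p = 3 \<Longrightarrow> can_exchange G x y u c \<Longrightarrow> found G p x y z u c (exchange x u c)"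

definition config :: "state \<Rightarrow> nat rooted_cycle" where
  "config s = Rooted (s ''nx'') {i. 0 < s ''on'' i} (s ''h'' 0)"

definition reads_graph :: "nat graph \<Rightarrow> nat \<Rightarrow> state \<Rightarrow> bool" where
  "reads_graph G n s \<longleftrightarrow> s ''n'' 0 = n \<and> (\<forall>i < n. s ''row'' i = i * n) \<and>
     s ''adj'' = (\<lambda>i. if i < n * n \<and> {i div n, i mod n} \<in> edges G then 1 else 0)"

text \<open>All successors are bounded, also those of vertices off the cycle, since guards may look them up
  before they test membership.\<close>

definition in_range :: "nat \<Rightarrow> state \<Rightarrow> bool" where
  "in_range n s \<longleftrightarrow> (\<forall>i. s ''nx'' i < n) \<and> (\<forall>v \<in> {''h'', ''x'', ''y'', ''z'', ''u''}. s v 0 < n)"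

lemma bval_Adj:
  assumes "reads_graph G n s" "aval d s < n" "aval e s < n"
  shows "bval (Adj d e) s \<longleftrightarrow> adj G (aval d s) (aval e s)"
proof -
  let ?i = "aval d s * n + aval e s"
  have "?i div n = aval d s" "?i mod n = aval e s" using assms(3) by auto
  moreover have "?i < n * n"
  proof -
    have "?i < Suc (aval d s) * n" using assms(3) by simp
    also have "\<dots> \<le> n * n" using assms(2) by (intro mult_le_mono1) simp
    finally show ?thesis .
  qed
  ultimately show ?thesis using assms by (simp add: Adj_def reads_graph_def adj_def)
qed

lemma range_vars:
  assumes "in_range n s"
  shows "s ''nx'' i < n" "s ''h'' 0 < n" "s ''x'' 0 < n" "s ''y'' 0 < n" "s ''z'' 0 < n" "s ''u'' 0 < n"
  using assms by (auto simp: in_range_def)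

context
  fixes G :: "nat graph" and n :: nat and s :: state
  assumes rg: "reads_graph G n s" and ir: "in_range n s"
begin

lemma bval_Triangle_At_Base: "bval Triangle_At_Base s \<longleftrightarrow> triangle_at_base G (config s)"
  unfolding Triangle_At_Base_def
  by (subst bval_Adj[OF rg]) (auto simp: range_vars[OF ir] triangle_at_base_def config_def)

lemma bval_May_Splice: "bval May_Splice s \<longleftrightarrow> may_splice G (config s) (s ''u'' 0)"
  by (auto simp: May_Splice_def may_splice_def bval_Triangle_At_Base Period3_def)
    (auto simp: config_def)

lemma bval_May_Bypass: "bval May_Bypass s \<longleftrightarrow> may_bypass G (config s) (s ''u'' 0)"
  by (auto simp: May_Bypass_def may_bypass_def bval_Triangle_At_Base)
    (auto simp: config_def)

end

lemma run_Splice: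
  "config (run (Splice a) s) = splice (s ''u'' 0) (s a 0) (config s)"
  "v \<notin> {''nx'', ''on''} \<Longrightarrow> run (Splice a) s v = s v" if "a \<notin> {''nx'', ''on''}"
  using that by (auto simp: Splice_def config_def splice_def)

lemma run_Bypass:
  "config (run Bypass s) = bypass (s ''u'' 0) (config s)"
  "v \<notin> {''nx'', ''on'', ''h''} \<Longrightarrow> run Bypass s v = s v"
  by (auto simp: Bypass_def config_def bypass_def)

lemma run_Reroot:
  "config (run Reroot s) = reroot (s ''u'' 0) (config s)"
  "v \<notin> {''h''} \<Longrightarrow> run Reroot s v = s v"
  by (auto simp: Reroot_def Period3_def config_def reroot_def)

lemma run_Start_Triangle:
  "config (run Start_Triangle s) = start_triangle (s ''x'' 0) (s ''y'' 0) (s ''z'' 0) (config s)"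
  "v \<notin> {''nx'', ''on'', ''h''} \<Longrightarrow> run Start_Triangle s v = s v"
  by (auto simp: Start_Triangle_def config_def start_triangle_def)

lemma run_Start_Edge:
  "config (run Start_Edge s) = start_edge (s ''x'' 0) (s ''y'' 0) (config s)"
  "v \<notin> {''nx'', ''on'', ''h''} \<Longrightarrow> run Start_Edge s v = s v"
  by (auto simp: Start_Edge_def config_def start_edge_def)

lemma in_range_Splice:
  "in_range n s \<Longrightarrow> a \<in> {''x'', ''y'', ''z''} \<Longrightarrow> in_range n (run (Splice a) s)"
  by (auto simp: in_range_def Splice_def)

lemma in_range_Reroot: "in_range n s \<Longrightarrow> in_range n (run Reroot s)"
  and in_range_Bypass: "in_range n s \<Longrightarrow> in_range n (run Bypass s)"
  and in_range_Start_Triangle: "in_range n s \<Longrightarrow> in_range n (run Start_Triangle s)"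
  and in_range_Start_Edge: "in_range n s \<Longrightarrow> in_range n (run Start_Edge s)"
  by (auto simp: in_range_def Reroot_def Bypass_def Start_Triangle_def Start_Edge_def)

lemma run_Seqs [simp]: "run (Seqs []) s = s" "run (Seqs (c # cs)) s = run (Seqs cs) (run c s)"
  by simp_all

text \<open>Lists of statements stay folded, so that the effect of each statement is described by its own
  lemma.\<close>

declare Seqs.simps [simp del]

lemma found_exchange:
  "p = 3 \<Longrightarrow> can_exchange G x y u c \<Longrightarrow> found G p x y z u c (splice u x (bypass u c))"
  using found.intros(4) unfolding exchange_def .

context
  fixes G :: "nat graph" and n :: nat and s :: state
  assumes rg: "reads_graph G n s" and ir: "in_range n s"
begin

lemma move_found:
  assumes m: "(b, c) \<in> set moves" and b: "bval b s"
    and empty: "s ''p'' 0 < 2 \<Longrightarrow> members (config s) = {}"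
  shows "found G (s ''p'' 0) (s ''x'' 0) (s ''y'' 0) (s ''z'' 0) (s ''u'' 0) (config s) (config (run c s))"
    and "in_range n (run c s)"
    and "v \<notin> {''nx'', ''on'', ''h''} \<Longrightarrow> run c s v = s v"
proof -
  note simps = bval_Adj[OF rg] range_vars[OF ir] bval_May_Splice[OF rg ir] bval_May_Bypass[OF rg ir]
    run_Splice run_Bypass run_Reroot run_Start_Triangle run_Start_Edge
  note ranges = in_range_Splice in_range_Reroot in_range_Bypass in_range_Start_Triangle in_range_Start_Edge
  show "in_range n (run c s)" using m ir unfolding moves_def Let_def
    by (auto intro!: ranges)
  show "v \<notin> {''nx'', ''on'', ''h''} \<Longrightarrow> run c s v = s v" using m unfolding moves_def Let_def
    by (auto simp: simps)
  show "found G (s ''p'' 0) (s ''x'' 0) (s ''y'' 0) (s ''z'' 0) (s ''u'' 0) (config s) (config (run c s))"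
  proof -
    have no: "s ''on'' i = 0" if "s ''p'' 0 < 2" for i
      using empty[OF that] by (auto simp: config_def)
    have "list_all (\<lambda>(b, c). bval b s \<longrightarrow>
        found G (s ''p'' 0) (s ''x'' 0) (s ''y'' 0) (s ''z'' 0) (s ''u'' 0) (config s) (config (run c s))) moves"
      unfolding moves_def Let_def list.pred_inject prod.case
      by (intro conjI impI TrueI; simp add: simps;
          (intro found.intros(1-3) grow.intros found_exchange)?; simp add: config_def can_exchange_def no)
    then show ?thesis using m b by (auto simp: list_all_iff)
  qed
qed

lemma found_move:
  assumes "found G (s ''p'' 0) (s ''x'' 0) (s ''y'' 0) (s ''z'' 0) (s ''u'' 0) (config s) c'"
  shows "\<exists>(b, c) \<in> set moves. bval b s"
proof -
  note simps = bval_Adj[OF rg] range_vars[OF ir] bval_May_Splice[OF rg ir] bval_May_Bypass[OF rg ir]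
  have on: "0 < s ''on'' i \<longleftrightarrow> i \<in> members (config s)" and nx: "s ''nx'' = nxt (config s)" for i
    by (simp_all add: config_def)
  show ?thesis using assms
  proof cases
    case 3
    from 3(2) show ?thesis
      by cases (use 3(1) in \<open>auto simp: moves_def Let_def simps on nx[symmetric]\<close>)
  qed (auto simp: moves_def Let_def simps on nx[symmetric] can_exchange_def)
qed

end

section \<open>The order of the search\<close>

text \<open>The position of a candidate in the order of the odometer: phase and candidate are the digits of
  a number in base \<open>n\<close>, the phase being the unbounded leading digit.\<close>

definition index :: "nat \<Rightarrow> nat \<Rightarrow> nat \<Rightarrow> nat \<Rightarrow> nat \<Rightarrow> nat \<Rightarrow> nat" where
  "index n p x y z u = (((p * n + x) * n + y) * n + z) * n + u"

lemma digit_less: "(a::nat) < A \<Longrightarrow> b < n \<Longrightarrow> a * n + b < A * n"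
proof -
  assume "a < A" "b < n"
  then have "a * n + b < Suc a * n" by simp
  also have "\<dots> \<le> A * n" using \<open>a < A\<close> by (intro mult_le_mono1) simp
  finally show ?thesis .
qed

text \<open>Phase \<open>p\<close> occupies the positions from \<open>p * n ^ 4\<close> up to, but not including,
  \<open>(p + 1) * n ^ 4\<close>. Hence the current phase tells which phases are complete.\<close>

lemma index_less:
  assumes "p < q" "x < n" "y < n" "z < n" "u < n"
  shows "index n p x y z u < q * n ^ 4"
proof -
  have "index n p x y z u < q * n * n * n * n"
    unfolding index_def using assms by (intro digit_less)
  then show ?thesis by (simp add: power4_eq_xxxx mult.assoc)
qed

lemma index_ge: "p * n ^ 4 \<le> index n p x y z u"
proof -
  have "p * n * n * n * n \<le> index n p x y z u"
    unfolding index_def by (intro trans_le_add1 mult_le_mono1 order_refl)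
  then show ?thesis by (simp add: power4_eq_xxxx mult.assoc)
qed

lemma digit_inj: "a * n + b = a' * n + b' \<Longrightarrow> b < n \<Longrightarrow> b' < n \<Longrightarrow> a = a' \<and> b = (b'::nat)"
  by (metis add.commute div_mult_self1 mod_mult_self1 div_less mod_less add_cancel_right_left
      gr_implies_not0 mult.commute)

lemma index_inj:
  assumes "index n p x y z u = index n p' x' y' z' u'" "x < n" "y < n" "z < n" "u < n"
    "x' < n" "y' < n" "z' < n" "u' < n"
  shows "p = p' \<and> x = x' \<and> y = y' \<and> z = z' \<and> u = u'"
  using assms unfolding index_def by (blast dest: digit_inj)

definition state_index :: "nat \<Rightarrow> state \<Rightarrow> nat" where
  "state_index n s = index n (s ''p'' 0) (s ''x'' 0) (s ''y'' 0) (s ''z'' 0) (s ''u'' 0)"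

lemma run_Tick:
  assumes n: "s ''n'' 0 = n" and r: "in_range n s"
  defines "s' \<equiv> run (Tick [''u'', ''z'', ''y'', ''x'']) s"
  shows "v \<notin> {''p'', ''x'', ''y'', ''z'', ''u''} \<Longrightarrow> s' v = s v"
    and "in_range n s'" and "state_index n s' = Suc (state_index n s)"
    and "s' ''p'' 0 \<le> Suc (s ''p'' 0)" and "s ''p'' 0 \<le> s' ''p'' 0"
proof -
  have lt: "s ''x'' 0 < n" "s ''y'' 0 < n" "s ''z'' 0 < n" "s ''u'' 0 < n"
    using r by (auto simp: in_range_def)
  show "v \<notin> {''p'', ''x'', ''y'', ''z'', ''u''} \<Longrightarrow> s' v = s v"
    by (simp add: s'_def)
  show "in_range n s'" using r n by (auto simp: s'_def in_range_def)
  show "s' ''p'' 0 \<le> Suc (s ''p'' 0)" "s ''p'' 0 \<le> s' ''p'' 0" by (simp_all add: s'_def)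
  have "Suc a = n \<or> Suc a < n" if "a < n" for a using that by linarith
  then consider "Suc (s ''u'' 0) < n" | "Suc (s ''u'' 0) = n" "Suc (s ''z'' 0) < n"
    | "Suc (s ''u'' 0) = n" "Suc (s ''z'' 0) = n" "Suc (s ''y'' 0) < n"
    | "Suc (s ''u'' 0) = n" "Suc (s ''z'' 0) = n" "Suc (s ''y'' 0) = n" "Suc (s ''x'' 0) < n"
    | "Suc (s ''u'' 0) = n" "Suc (s ''z'' 0) = n" "Suc (s ''y'' 0) = n" "Suc (s ''x'' 0) = n"
    using lt by blast
  then show "state_index n s' = Suc (state_index n s)"
  proof cases
    case 1 then show ?thesis using n by (simp add: s'_def state_index_def index_def)
  next
    case 2
    have "\<And>a. a * n + s ''u'' 0 + 1 = Suc a * n" using 2 by simp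
    then show ?thesis using n 2 by (simp add: s'_def state_index_def index_def)
  next
    case 3
    then show ?thesis using n by (simp add: s'_def state_index_def index_def) (simp flip: 3(1) add: algebra_simps)
  next
    case 4
    then show ?thesis using n by (simp add: s'_def state_index_def index_def) (simp flip: 4(1) add: algebra_simps)
  next
    case 5
    then show ?thesis using n by (simp add: s'_def state_index_def index_def) (simp flip: 5(1) add: algebra_simps)
  qed
qed

section \<open>Correctness and running time of the search\<close>

lemma run_First_Of:
  assumes "\<And>b c. (b, c) \<in> set ms \<Longrightarrow> bval b s \<Longrightarrow> P (run Restart (run c s))"
    and "(\<And>b c. (b, c) \<in> set ms \<Longrightarrow> \<not> bval b s) \<Longrightarrow> P (run d s)"
  shows "P (run (First_Of ms d) s)"
  using assms
proof (induction ms)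
  case (Cons m ms)
  obtain b c where m: "m = (b, c)" by fastforce
  show ?case
  proof (cases "bval b s")
    case True
    then show ?thesis using Cons.prems(1)[of b c] by (simp add: m)
  next
    case False
    have "P (run (First_Of ms d) s)"
      by (rule Cons.IH) (use Cons.prems False m in auto)
    then show ?thesis using False by (simp add: m)
  qed
qed simp

lemma loop_free_First_Of:
  "\<forall>(b, c) \<in> set ms. loop_free c \<Longrightarrow> loop_free d \<Longrightarrow> loop_free (First_Of ms d)"
  by (induction ms d rule: First_Of.induct) (auto simp: Restart_def)

lemma loop_free_Search_Body: "loop_free Search_Body"
  unfolding Search_Body_def
  by (intro loop_free_First_Of)
    (simp_all add: moves_def Let_def Start_Triangle_def Start_Edge_def Reroot_def Bypass_def Splice_def)

text \<open>Once phase 4 is reached, the last conjunct excludes every move. While no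
  cycle has been found, the base 0 with successor 0 is in place for the output of a single vertex,
  which is the answer for graphs without edges.\<close>

definition search_inv :: "nat graph \<Rightarrow> nat \<Rightarrow> state \<Rightarrow> bool" where
  "search_inv G n s \<longleftrightarrow> reads_graph G n s \<and> in_range n s \<and> s ''p'' 0 \<le> 4 \<and>
     (if members (config s) = {} then nxt (config s) 0 = 0 \<and> base (config s) = 0
      else 2 \<le> s ''p'' 0 \<and> cycle_inv G (config s)) \<and>
     (\<forall>p x y z u c. x < n \<longrightarrow> y < n \<longrightarrow> z < n \<longrightarrow> u < n \<longrightarrow>
        index n p x y z u < state_index n s \<longrightarrow> \<not> found G p x y z u (config s) c)"

text \<open>A move lowers the potential and may reset the position; otherwise the position advances. It
  stays below \<open>4 * n ^ 4\<close>, so a drop in the potential outweighs the reset.\<close>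

definition search_measure :: "nat graph \<Rightarrow> nat \<Rightarrow> state \<Rightarrow> nat" where
  "search_measure G n s = potential G (config s) * Suc (4 * n ^ 4) + (4 * n ^ 4 - state_index n s)"

text \<open>The order of the phases matters: an edge is a suitable start only in the absence of triangles,
  and an exchange is known to make progress only when no lengthening move is possible.\<close>

lemma found_progress:
  assumes G: "simple_graph G" and free: "two_K2_free G"
    and inv: "members c \<noteq> {} \<Longrightarrow> cycle_inv G c"
    and f: "found G p x y z u c c'"
    and tf: "p = 1 \<Longrightarrow> \<not> contains_triangle G"
    and ng: "p = 3 \<Longrightarrow> \<forall>x y z u c'. \<not> grow G x y z u c c'"
  shows "cycle_inv G c'" "potential G c' < potential G c"
proof -
  have "cycle_inv G c' \<and> potential G c' < potential G c"
    using f
  proof cases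
    case 1
    have "cycle_inv G c'" unfolding 1(1) by (rule cycle_inv_start_triangle[OF G]) (use 1 in auto)
    then show ?thesis
      using 1 potential_less_if_longer[OF G cycle_inv_members[OF G], of c' c]
      by (simp add: start_triangle_def card_gt_0_iff)
  next
    case 2
    have "cycle_inv G c'" unfolding 2(1) by (rule cycle_inv_start_edge[OF G]) (use 2 tf in auto)
    then show ?thesis
      using 2 potential_less_if_longer[OF G cycle_inv_members[OF G], of c' c]
      by (simp add: start_edge_def card_gt_0_iff)
  next
    case 3
    then have "members c \<noteq> {}" by (auto elim!: grow.cases simp: may_splice_def may_bypass_def)
    then show ?thesis using 3 inv cycle_inv_grow[OF G] potential_grow[OF G] by blast
  next
    case 4
    then have "members c \<noteq> {}" by (auto simp: can_exchange_def may_bypass_def)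
    then show ?thesis
      using 4 inv cycle_inv_exchange[OF G] potential_exchange[OF G free] ng by blast
  qed
  then show "cycle_inv G c'" "potential G c' < potential G c" by auto
qed

text \<open>Short insertions do not constrain all of \<open>y\<close> and \<open>z\<close>; the search only runs through vertices, so
  these parameters have to be chosen as vertices.\<close>

lemma grow_relevant:
  assumes G: "simple_graph G" and g: "grow G x y z u c c'"
  shows "\<exists>y' z'. x \<in> verts G \<and> y' \<in> verts G \<and> z' \<in> verts G \<and> u \<in> verts G \<and> grow G x y' z' u c c'"
  using g
proof cases
  case grow1
  then have "grow G x x x u c c'" "x \<in> verts G" "u \<in> verts G"
    using grow.grow1[OF grow1(2-5)] adj_verts[OF G] by blast+
  then show ?thesis by blast
next
  case grow2
  then have "grow G x y y u c c'" "x \<in> verts G" "u \<in> verts G" "y \<in> verts G"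
    using grow.grow2[OF grow2(2-7)] adj_verts[OF G] by blast+
  then show ?thesis by blast
next
  case grow3
  then show ?thesis using g adj_verts[OF G] by blast
next
  case grow_detour
  then have "grow G x y y u c c'" "x \<in> verts G" "u \<in> verts G" "y \<in> verts G"
    using grow.grow_detour[OF grow_detour(2-7)] adj_verts[OF G] by blast+
  then show ?thesis by blast
qed

lemma run_Restart:
  "v \<notin> {''p'', ''x'', ''y'', ''z'', ''u''} \<Longrightarrow> run Restart s v = s v"
  "run Restart s ''p'' 0 = 2" "v \<in> {''x'', ''y'', ''z'', ''u''} \<Longrightarrow> run Restart s v 0 = 0"
  by (auto simp: Restart_def)

lemma config_cong: "s ''nx'' = s' ''nx'' \<Longrightarrow> s ''on'' = s' ''on'' \<Longrightarrow> s ''h'' = s' ''h'' \<Longrightarrow> config s = config s'"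
  by (simp add: config_def)

lemma reads_graph_cong:
  "reads_graph G n s \<Longrightarrow> (\<And>v. v \<in> {''n'', ''row'', ''adj''} \<Longrightarrow> s' v = s v) \<Longrightarrow> reads_graph G n s'"
  by (simp add: reads_graph_def)

context
  fixes G :: "nat graph" and n :: nat
  assumes G: "simple_graph G" and verts: "verts G = {..<n}"
begin

text \<open>A completed phase has ruled out all of its moves.\<close>

lemma search_inv_not_found:
  assumes inv: "search_inv G n s" and p: "p < s ''p'' 0"
  shows "\<not> found G p x y z u (config s) c"
proof
  assume f: "found G p x y z u (config s) c"
  have "\<exists>x y z u. x < n \<and> y < n \<and> z < n \<and> u < n \<and> found G p x y z u (config s) c"
    using f
  proof cases
    case 1
    have "x < n" "y < n" "z < n" using adj_verts[OF G] 1(4,5) verts by auto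
    moreover have "found G p x y z x (config s) c"
      unfolding 1(1) by (rule found.intros(1)) (use 1 in auto)
    ultimately show ?thesis by blast
  next
    case 2
    have "x < n" "y < n" using adj_verts[OF G] 2(4) verts by auto
    moreover have "found G p x y x x (config s) c"
      unfolding 2(1) by (rule found.intros(2)) (use 2 in auto)
    ultimately show ?thesis by blast
  next
    case 3
    obtain y' z' where lt: "x < n" "y' < n" "z' < n" "u < n" and g: "grow G x y' z' u (config s) c"
      using grow_relevant[OF G 3(2)] verts by auto
    have "found G p x y' z' u (config s) c" by (rule found.intros(3)[OF 3(1) g])
    with lt show ?thesis by blast
  next
    case 4
    have "x < n" "y < n" "u < n" using adj_verts[OF G] 4(3) verts by (auto simp: can_exchange_def)
    moreover have "found G p x y x u (config s) c"
      unfolding 4(1) by (rule found.intros(4)) (use 4 in auto)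
    ultimately show ?thesis by blast
  qed
  then obtain x y z u where lt: "x < n" "y < n" "z < n" "u < n" and f': "found G p x y z u (config s) c"
    by blast
  have "index n p x y z u < state_index n s"
    unfolding state_index_def by (rule order_less_le_trans[OF index_less[OF p lt] index_ge])
  then show False using inv lt f' by (auto simp: search_inv_def)
qed

lemma search_inv_no_triangle:
  assumes "search_inv G n s" "0 < s ''p'' 0" "members (config s) = {}"
  shows "\<not> contains_triangle G"
proof
  assume "contains_triangle G"
  then obtain x y z where "adj G x y" "adj G y z" "adj G x z"
    unfolding contains_triangle_adj by metis
  then have "found G 0 x y z x (config s) (start_triangle x y z (config s))"
    by (rule found.intros(1)[OF refl assms(3)])
  then show False using search_inv_not_found[OF assms(1,2)] by metis
qed

lemma search_inv_no_grow:
  assumes "search_inv G n s" "2 < s ''p'' 0"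
  shows "\<not> grow G x y z u (config s) c"
proof
  assume g: "grow G x y z u (config s) c"
  show False using search_inv_not_found[OF assms] found.intros(3)[OF refl g] by metis
qed

context
  assumes free: "two_K2_free G"
begin

lemma search_step:
  assumes inv: "search_inv G n s" and p: "s ''p'' 0 < 4"
  shows "search_inv G n (run Search_Body s) \<and> search_measure G n (run Search_Body s) < search_measure G n s"
  unfolding Search_Body_def
proof (rule run_First_Of)
  have rg: "reads_graph G n s" and ir: "in_range n s" using inv by (auto simp: search_inv_def)
  note lt = range_vars[OF ir]
  have i4: "state_index n s < 4 * n ^ 4"
    unfolding state_index_def by (rule index_less) (use p lt in auto)
  let ?f = "\<lambda>c'. found G (s ''p'' 0) (s ''x'' 0) (s ''y'' 0) (s ''z'' 0) (s ''u'' 0) (config s) c'"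
  {
    fix b c assume m: "(b, c) \<in> set moves" "bval b s"
    let ?t = "run c s" let ?r = "run Restart ?t"
    have e: "s ''p'' 0 < 2 \<Longrightarrow> members (config s) = {}"
      using inv by (auto simp: search_inv_def split: if_splits)
    note mf = move_found[OF rg ir m e]
    have cfg: "config ?r = config ?t" by (intro config_cong) (simp_all add: run_Restart(1))
    have tf: "s ''p'' 0 = 1 \<Longrightarrow> \<not> contains_triangle G"
      using search_inv_no_triangle[OF inv] e by simp
    have ng: "s ''p'' 0 = 3 \<Longrightarrow> \<forall>x y z u c'. \<not> grow G x y z u (config s) c'"
      using search_inv_no_grow[OF inv] by simp
    have ci: "members (config s) \<noteq> {} \<Longrightarrow> cycle_inv G (config s)"
      using inv by (auto simp: search_inv_def)
    note pr = found_progress[OF G free ci mf(1) tf ng]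
    have ne: "members (config ?t) \<noteq> {}" using pr(1) by (auto simp: cycle_inv_def)
    have rg': "reads_graph G n ?r"
      by (rule reads_graph_cong[OF rg]) (auto simp: run_Restart(1) mf(3))
    have "0 < n" using lt(2) by simp
    then have ir': "in_range n ?r" using mf(2) by (auto simp: in_range_def run_Restart)
    have idx: "state_index n ?r = 2 * n ^ 4"
      by (simp add: state_index_def run_Restart index_def power4_eq_xxxx)
    have nf: "\<not> found G q x y z u (config ?t) c'"
      if "index n q x y z u < 2 * n ^ 4" "x < n" "y < n" "z < n" "u < n" for q x y z u c'
    proof -
      \<comment> \<open>These positions belong to phases 0 and 1, which find nothing once a cycle exists.\<close>
      have "q < 2"
      proof (rule ccontr)
        assume "\<not> q < 2"
        then have "2 * n ^ 4 \<le> q * n ^ 4" by (intro mult_le_mono1) simp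
        then show False using index_ge[of q n x y z u] that(1) by linarith
      qed
      then show ?thesis using ne by (auto elim: found.cases)
    qed
    have "search_inv G n ?r"
      unfolding search_inv_def cfg idx using rg' ir' pr(1) ne nf run_Restart(2) by simp
    moreover have "search_measure G n ?r < search_measure G n s"
    proof -
      have "Suc (potential G (config ?t)) * Suc (4 * n ^ 4) \<le> potential G (config s) * Suc (4 * n ^ 4)"
        using pr(2) by (intro mult_le_mono1) simp
      then show ?thesis unfolding search_measure_def cfg by simp
    qed
    ultimately show "search_inv G n ?r \<and> search_measure G n ?r < search_measure G n s" ..
  }
  assume none: "\<And>b c. (b, c) \<in> set moves \<Longrightarrow> \<not> bval b s"
  let ?r = "run (Tick [''u'', ''z'', ''y'', ''x'']) s"
  have n: "s ''n'' 0 = n" using rg by (simp add: reads_graph_def)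
  note tick = run_Tick[OF n ir]
  have cfg: "config ?r = config s" by (intro config_cong) (simp_all add: tick(1) del: Tick.simps)
  have nf: "\<not> ?f c'" for c' using found_move[OF rg ir] none by blast
  have rg': "reads_graph G n ?r"
    by (rule reads_graph_cong[OF rg], rule tick(1)) auto
  have "\<not> found G q x y z u (config s) c'"
    if "index n q x y z u < Suc (state_index n s)" "x < n" "y < n" "z < n" "u < n" for q x y z u c'
  proof (cases "index n q x y z u = state_index n s")
    case True
    then have "q = s ''p'' 0 \<and> x = s ''x'' 0 \<and> y = s ''y'' 0 \<and> z = s ''z'' 0 \<and> u = s ''u'' 0"
      unfolding state_index_def by (rule index_inj) (use that lt in auto)
    then show ?thesis using nf by blast
  next
    case False
    then have "index n q x y z u < state_index n s" using that(1) by linarith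
    then show ?thesis using inv that(2-) by (auto simp: search_inv_def)
  qed
  moreover have "?r ''p'' 0 \<le> 4" "2 \<le> s ''p'' 0 \<Longrightarrow> 2 \<le> ?r ''p'' 0" using tick(4,5) p by linarith+
  ultimately have "search_inv G n ?r"
    using inv rg' tick(2) unfolding search_inv_def cfg tick(3) by (auto simp del: Tick.simps run.simps)
  moreover have "search_measure G n ?r < search_measure G n s"
    unfolding search_measure_def cfg tick(3) using i4 by linarith
  ultimately show "search_inv G n ?r \<and> search_measure G n ?r < search_measure G n s" ..
qed

lemma search_inv_final:
  assumes inv: "search_inv G n s" and p: "\<not> s ''p'' 0 < 4"
    and us: "distinct us" "map (s ''nx'') us = rotate1 us"
      "set us = (if members (config s) = {} then {0} else members (config s))"
  shows "required_output G (cyclic_graph us)"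
proof (cases "members (config s) = {}")
  case True
  have "0 < n" using inv by (auto simp: search_inv_def in_range_def)
  have "length us = Suc 0" using distinct_card[OF us(1)] us(3) True by simp
  then have "us = [0]" using us(3) True by (auto simp: length_Suc_conv)
  moreover have "\<not> adj G a b" for a b
    using search_inv_not_found[OF inv, of 1 a b a a] found.intros(2)[OF refl True, of G a b a a] p
    by auto
  ultimately show ?thesis using required_output_single_vertex[OF G, of 0] verts \<open>0 < n\<close> by simp
next
  case False
  then have ci: "cycle_inv G (config s)" using inv by (simp add: search_inv_def)
  have "\<not> can_exchange G x y u (config s)" for x y u
    using search_inv_not_found[OF inv, of 3 x y x u] found.intros(4)[OF refl, of G x y u "config s" x] p
    by auto
  moreover have "\<not> grow G x y z u (config s) c" for x y z u c
    using search_inv_no_grow[OF inv] p by simp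
  ultimately have "undominated G (members (config s)) = {}"
    by (intro dominating_if_stuck[OF G free ci])
  then show ?thesis
    using required_output_cyclic_graph[OF G ci] us False by (simp add: config_def)
qed

end

end

lemma card_edges_le:
  assumes G: "simple_graph G" and verts: "verts G = {..<n}"
  shows "card (edges G) \<le> n * n"
proof -
  have "edges G \<subseteq> (\<lambda>(a, b). {a, b}) ` ({..<n} \<times> {..<n})"
  proof
    fix e assume "e \<in> edges G"
    then obtain a b where "e = {a, b}" "adj G a b" using edge_adj[OF G] by metis
    then show "e \<in> (\<lambda>(a, b). {a, b}) ` ({..<n} \<times> {..<n})"
      using adj_verts[OF G] verts by (auto simp: image_iff)
  qed
  then have "card (edges G) \<le> card ({..<n} \<times> {..<n})"
    by (meson card_image_le card_mono finite_SigmaI finite_imageI finite_lessThan le_trans)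
  then show ?thesis by simp
qed

lemma search_measure_le:
  assumes G: "simple_graph G" and verts: "verts G = {..<n}"
  shows "search_measure G n s \<le> (n * Suc (n * n) + n * n) * Suc (4 * n ^ 4) + 4 * n ^ 4"
proof -
  have "potential G c \<le> n * Suc (n * n) + n * n" for c
    unfolding potential_def
    using card_edges_le[OF G verts] le_trans[OF card_undominated[OF G] card_edges_le[OF G verts]]
    by (intro add_mono mult_mono) (auto simp: verts)
  then show ?thesis unfolding search_measure_def by (intro add_mono mult_le_mono1) auto
qed

section \<open>The complete program\<close>

definition Build_Rows :: com where
  "Build_Rows = While (Less (Var ''i'') (Var ''n''))
     (Seq (Assign ''row'' (Plus (Var ''i'') (N 1)) (Plus (Cell ''row'' (Var ''i'')) (Var ''n'')))
        (Let_Var ''i'' (Plus (Var ''i'') (N 1))))"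

definition Search :: com where
  "Search = While (Less (Var ''p'') (N 4)) Search_Body"

definition Write_Cycle :: com where
  "Write_Cycle = Seq (Seqs [Assign ''out'' (N 0) (Var ''h''), Let_Var ''len'' (N 1),
       Let_Var ''cur'' (Nxt (Var ''h''))])
     (While (Not (Eq (Var ''cur'') (Var ''h'')))
       (Seqs [Assign ''out'' (Var ''len'') (Var ''cur''), Let_Var ''len'' (Plus (Var ''len'') (N 1)),
         Let_Var ''cur'' (Nxt (Var ''cur''))]))"

definition Find_Dominating_Cycle :: com where
  "Find_Dominating_Cycle = Seq Build_Rows (Seq Search Write_Cycle)"

lemma exec_Build_Rows:
  assumes n: "s ''n'' 0 = n" and zero: "s ''i'' 0 = 0" "s ''row'' 0 = 0"
  shows "\<exists>t s'. exec Build_Rows s t s' \<and> t \<le> Suc (n * 3) \<and> (\<forall>i < n. s' ''row'' i = i * n) \<and>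
    (\<forall>v. v \<notin> {''i'', ''row''} \<longrightarrow> s' v = s v)"
proof -
  let ?I = "\<lambda>r. r ''i'' 0 \<le> n \<and> (\<forall>i \<le> r ''i'' 0. r ''row'' i = i * n) \<and>
    (\<forall>v. v \<notin> {''i'', ''row''} \<longrightarrow> r v = s v)"
  let ?c = "Seq (Assign ''row'' (Plus (Var ''i'') (N 1)) (Plus (Cell ''row'' (Var ''i'')) (Var ''n'')))
        (Let_Var ''i'' (Plus (Var ''i'') (N 1)))"
  have "\<exists>t s'. exec (While (Less (Var ''i'') (Var ''n'')) ?c) s t s' \<and>
      t \<le> Suc ((n - s ''i'' 0) * Suc (cost ?c)) \<and> ?I s' \<and> \<not> bval (Less (Var ''i'') (Var ''n'')) s'"
  proof (rule exec_while[where I = ?I and \<mu> = "\<lambda>r. n - r ''i'' 0"])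
    show "?I (run ?c r) \<and> n - run ?c r ''i'' 0 < n - r ''i'' 0"
      if "?I r" "bval (Less (Var ''i'') (Var ''n'')) r" for r
      using that n by (auto simp: le_Suc_eq)
  qed (use zero in auto)
  then obtain t s' where "exec Build_Rows s t s'" "t \<le> Suc (n * 3)" "?I s'"
      "\<not> bval (Less (Var ''i'') (Var ''n'')) s'"
    by (auto simp: Build_Rows_def zero)
  then show ?thesis using n by (intro exI[of _ t] exI[of _ s']) auto
qed

text \<open>Following successors from the base, the loop stops when it is back at the base for the first
  time, which is after exactly one turn because the list has no repetitions.\<close>

lemma exec_Write_Cycle:
  assumes us: "distinct us" "us \<noteq> []" "hd us = s ''h'' 0" "map (s ''nx'') us = rotate1 us"
  shows "\<exists>t s'. exec Write_Cycle s t s' \<and> t \<le> 5 + length us * 5 \<and> output_list s' = us"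
proof -
  let ?k = "length us"
  let ?I = "\<lambda>r. r ''nx'' = s ''nx'' \<and> r ''h'' 0 = us ! 0 \<and> 1 \<le> r ''len'' 0 \<and> r ''len'' 0 \<le> ?k \<and>
    (\<forall>j < r ''len'' 0. r ''out'' j = us ! j) \<and> r ''cur'' 0 = us ! (r ''len'' 0 mod ?k)"
  let ?b = "Not (Eq (Var ''cur'') (Var ''h''))"
  let ?c = "Seqs [Assign ''out'' (Var ''len'') (Var ''cur''), Let_Var ''len'' (Plus (Var ''len'') (N 1)),
         Let_Var ''cur'' (Nxt (Var ''cur''))]"
  let ?a = "Seqs [Assign ''out'' (N 0) (Var ''h''), Let_Var ''len'' (N 1),
       Let_Var ''cur'' (Nxt (Var ''h''))]"
  have h: "s ''h'' 0 = us ! 0" using us by (simp add: hd_conv_nth)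
  have nx: "s ''nx'' (us ! j) = us ! (Suc j mod ?k)" if "j < ?k" for j
    using nth_rotate1[OF that] us(4) that by (metis nth_map)
  have k: "0 < ?k" using us by simp
  have I0: "?I (run ?a s)" using h nx[of 0] k Suc_leI[OF k] by auto
  obtain t where t: "t \<le> cost ?a" "exec ?a s t (run ?a s)" using exec_loop_free[of ?a s] by auto
  have "\<exists>t s'. exec (While ?b ?c) (run ?a s) t s' \<and>
      t \<le> Suc ((?k - run ?a s ''len'' 0) * Suc (cost ?c)) \<and> ?I s' \<and> \<not> bval ?b s'"
  proof (rule exec_while[where I = ?I and \<mu> = "\<lambda>r. ?k - r ''len'' 0"])
    fix r assume I: "?I r" and b: "bval ?b r"
    then have lt: "r ''len'' 0 < ?k" by (cases "r ''len'' 0 = ?k") auto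
    then have cur: "r ''cur'' 0 = us ! (r ''len'' 0)" using I by simp
    show "?I (run ?c r) \<and> ?k - run ?c r ''len'' 0 < ?k - r ''len'' 0"
      using I lt cur nx[OF lt] by (auto simp: less_Suc_eq)
  qed (use I0 in auto)
  then obtain t' s' where w: "exec (While ?b ?c) (run ?a s) t' s'"
    "t' \<le> Suc ((?k - run ?a s ''len'' 0) * Suc (cost ?c))" "?I s'" "\<not> bval ?b s'" by blast
  have "us ! (s' ''len'' 0 mod ?k) = us ! 0" using w(3,4) by auto
  then have "s' ''len'' 0 mod ?k = 0" using us(1) k by (simp add: nth_eq_iff_index_eq)
  then have "s' ''len'' 0 = ?k" using w(3) k
    by (metis le_neq_implies_less mod_less not_one_le_zero)
  then have "output_list s' = us" using w(3) by (auto simp: output_list_def intro: nth_equalityI)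
  moreover have "exec Write_Cycle s (t + t') s'" unfolding Write_Cycle_def using t(2) w(1) by (rule exec.Seq)
  moreover have "t + t' \<le> 5 + ?k * 5"
  proof -
    have "cost ?a = 4" "Suc (cost ?c) = 5" by (simp_all add: Seqs.simps)
    then have "t \<le> 4" "t' \<le> Suc (?k * 5)" using t(1) w(2)
      by (auto simp del: run.simps intro: order_trans)
    then show ?thesis by simp
  qed
  ultimately show ?thesis by blast
qed

text \<open>\<open>X\<close> stands for the number of vertices. The main term is a bound for the measure of the search
  at its start, times the cost of one iteration.\<close>

definition time_bound :: "nat poly" where
  "time_bound = (let X = [:0, 1:] in
     [:1:] + X * [:3:] +
     ([:1:] + ((X * ([:1:] + X * X) + X * X) * ([:1:] + [:4:] * X ^ 4) + [:4:] * X ^ 4) *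
       [:Suc (cost Search_Body):] +
      ([:5:] + X * [:5:])))"

lemma poly_time_bound:
  "poly time_bound n = Suc (n * 3) +
    (Suc (((n * Suc (n * n) + n * n) * Suc (4 * n ^ 4) + 4 * n ^ 4) * Suc (cost Search_Body)) + (5 + n * 5))"
  by (simp add: time_bound_def Let_def algebra_simps)

lemma Find_Dominating_Cycle_correct:
  assumes G: "simple_graph G" and verts: "verts G = {..<n}" and free: "two_K2_free G"
  shows "\<exists>t s. exec Find_Dominating_Cycle (input_state G) t s \<and> t \<le> poly time_bound n \<and>
    distinct (output_list s) \<and> required_output G (cyclic_graph (output_list s))"
proof -
  let ?s = "input_state G" and ?M = "(n * Suc (n * n) + n * n) * Suc (4 * n ^ 4) + 4 * n ^ 4"
  have n: "0 < n" using G verts by (cases "n = 0") (auto simp: simple_graph_def)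
  have init: "?s ''n'' 0 = n" "?s ''adj'' = (\<lambda>i. if i < n * n \<and> {i div n, i mod n} \<in> edges G then 1 else 0)"
    "\<And>v i. v \<notin> {''n'', ''adj''} \<Longrightarrow> ?s v i = 0"
    by (simp_all add: input_state_def verts Let_def)
  obtain t1 s1 where e1: "exec Build_Rows ?s t1 s1" "t1 \<le> Suc (n * 3)"
    "\<forall>i < n. s1 ''row'' i = i * n" "\<forall>v. v \<notin> {''i'', ''row''} \<longrightarrow> s1 v = ?s v"
    using exec_Build_Rows[of ?s n] init by auto
  have z: "s1 v i = 0" if "v \<notin> {''n'', ''adj'', ''i'', ''row''}" for v i
    using e1(4) init(3)[of v i] that by simp
  have "config s1 = Rooted (\<lambda>_. 0) {} 0"
    by (simp add: config_def z fun_eq_iff)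
  moreover have "reads_graph G n s1"
    using e1(3,4) init(1,2) by (simp add: reads_graph_def)
  moreover have "in_range n s1" using n by (auto simp: in_range_def z)
  moreover have "s1 ''p'' 0 = 0" "state_index n s1 = 0" by (simp_all add: z state_index_def index_def)
  ultimately have "search_inv G n s1" by (simp add: search_inv_def)
  then have "\<exists>t s'. exec (While (Less (Var ''p'') (N 4)) Search_Body) s1 t s' \<and>
      t \<le> Suc (search_measure G n s1 * Suc (cost Search_Body)) \<and> search_inv G n s' \<and>
      \<not> bval (Less (Var ''p'') (N 4)) s'"
    by (intro exec_while[OF loop_free_Search_Body] search_step[OF G verts free]) auto
  then obtain t2 s2 where e2: "exec Search s1 t2 s2"
    "t2 \<le> Suc (search_measure G n s1 * Suc (cost Search_Body))" "search_inv G n s2" "\<not> s2 ''p'' 0 < 4"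
    by (auto simp: Search_def)
  have t2: "t2 \<le> Suc (?M * Suc (cost Search_Body))"
    by (rule order_trans[OF e2(2)])
      (simp only: Suc_le_mono, intro mult_le_mono1 search_measure_le[OF G verts])
  let ?V = "members (config s2)"
  have "\<exists>us. distinct us \<and> us \<noteq> [] \<and> hd us = s2 ''h'' 0 \<and> map (s2 ''nx'') us = rotate1 us \<and>
      set us = (if ?V = {} then {0} else ?V)"
  proof (cases "?V = {}")
    case True
    then show ?thesis using e2(3)
      by (intro exI[of _ "[0]"]) (auto simp: search_inv_def config_def)
  next
    case False
    then have "cyclic_succ (nxt (config s2)) ?V" "base (config s2) \<in> ?V"
      using e2(3) by (auto simp: search_inv_def cycle_inv_def)
    then obtain us where us: "distinct (base (config s2) # us)" "set (base (config s2) # us) = ?V"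
      "map (nxt (config s2)) (base (config s2) # us) = us @ [base (config s2)]"
      by (rule cyclic_succ_from)
    then show ?thesis using False
      by (intro exI[of _ "base (config s2) # us"]) (simp add: config_def)
  qed
  then obtain us where us: "distinct us" "us \<noteq> []" "hd us = s2 ''h'' 0" "map (s2 ''nx'') us = rotate1 us"
    "set us = (if ?V = {} then {0} else ?V)" by blast
  obtain t3 s3 where e3: "exec Write_Cycle s2 t3 s3" "t3 \<le> 5 + length us * 5" "output_list s3 = us"
    using exec_Write_Cycle[OF us(1-4)] by blast
  have "set us \<subseteq> {..<n}"
    using us(5) e2(3) n cycle_inv_members[OF G, of "config s2"] verts
    by (auto simp: search_inv_def split: if_splits)
  then have "length us \<le> n" using distinct_card[OF us(1)] card_mono[of "{..<n}" "set us"] by simp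
  then have "t1 + (t2 + t3) \<le> poly time_bound n"
    unfolding poly_time_bound using e1(2) t2 e3(2) by (intro add_mono) auto
  moreover have "exec Find_Dominating_Cycle ?s (t1 + (t2 + t3)) s3"
    unfolding Find_Dominating_Cycle_def using e1(1) e2(1) e3(1) by (intro exec.Seq)
  moreover have "required_output G (cyclic_graph us)"
    by (rule search_inv_final[OF G verts free e2(3,4) us(1,4,5)])
  ultimately show ?thesis using e3(3) us(1) by blast
qed

theorem theorem3:
  "(\<forall>G :: 'a graph. simple_graph G \<and> two_K2_free G \<longrightarrow>
      (\<exists>C. dominating_cycle_edge_or_vertex G C) \<and>
      (contains_triangle G \<longrightarrow> (\<exists>C. dominating_cycle_with_triangle G C))) \<and>
   poly_time_findable two_K2_free dominating_cycle_edge_or_vertex \<and>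
   poly_time_findable (\<lambda>G. two_K2_free G \<and> contains_triangle G) dominating_cycle_with_triangle"
proof (intro conjI)
  show "\<forall>G :: 'a graph. simple_graph G \<and> two_K2_free G \<longrightarrow>
      (\<exists>C. dominating_cycle_edge_or_vertex G C) \<and>
      (contains_triangle G \<longrightarrow> (\<exists>C. dominating_cycle_with_triangle G C))"
    using required_output_exists unfolding required_output_def by blast
  have find: "\<exists>t s. exec Find_Dominating_Cycle (input_state G) t s \<and> t \<le> poly time_bound (card (verts G)) \<and>
      distinct (output_list s) \<and> required_output G (cyclic_graph (output_list s))"
    if "simple_graph G" "verts G = {..<n}" "two_K2_free G" for G n
    using Find_Dominating_Cycle_correct[OF that] that(2) by simp
  have findable: "poly_time_findable P R"
    if PR: "\<And>G C. P G \<Longrightarrow> two_K2_free G \<and> (required_output G C \<longrightarrow> R G C)" for P R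
    unfolding poly_time_findable_def
  proof (intro exI[of _ Find_Dominating_Cycle] exI[of _ time_bound] allI impI, elim conjE)
    fix G n assume "simple_graph G" "verts G = {..<n}" "P G"
    then show "\<exists>t s. exec Find_Dominating_Cycle (input_state G) t s \<and>
        t \<le> poly time_bound (card (verts G)) \<and> distinct (output_list s) \<and> R G (cyclic_graph (output_list s))"
      using find[of G n] PR[of G] by blast
  qed
  show "poly_time_findable two_K2_free dominating_cycle_edge_or_vertex"
    by (rule findable) (simp add: required_output_def)
  show "poly_time_findable (\<lambda>G. two_K2_free G \<and> contains_triangle G) dominating_cycle_with_triangle"
    by (rule findable) (simp add: required_output_def)
qed

end
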